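(* Let $k=4$. For the HC-model the following statements are true. 1. If $m=1$ and $r=0$, or $m=0$ and $r=1$, then there exists $\lambda_{cr}\approx 2.31$ such that for $0<\lambda<\lambda_{cr}$ there is a unique AGM (with parameters $m,r$), which coincides with the only TIGM $\mu_0$; for $\lambda=\lambda_{cr}$ there are exactly two AGMs $\mu_0$ and $\mu'$, where $\mu'$ is an AGM that is not TI; and for $\lambda>\lambda_{cr}$ there are exactly three AGMs $\mu_0$, $\mu_1$ and $\mu_2$, where $\mu_1$ and $\mu_2$ are AGMs that are not TI. 2. If $m=1$ and $r=1$, then, with $\lambda_{cr}=16$, for $0<\lambda\le\lambda_{cr}$ there is a unique AGM, which coincides with the only TIGM $\mu_0$, and for $\lambda>\lambda_{cr}$ there are exactly three AGMs $\mu_0$, $\mu_1$ and $\mu_2$, where $\mu_1$ and $\mu_2$ are AGMs that are not TI. 3. If $m=2$ and $r=0$, or $m=0$ and $r=2$, then there exists $\lambda_{cr}\approx 9.48$ such that for $0<\lambda<\lambda_{cr}$ there is a unique AGM, which coincides with the only TIGM $\mu_0$; for $\lambda=\lambda_{cr}$ there are exactly two AGMs $\mu_0$ and $\mu'$, where $\mu'$ is an AGM that is not TI; and for $\lambda>\lambda_{cr}$ there are exactly three AGMs $\mu_0$, $\mu_1$ and $\mu_2$, where $\mu_1$ and $\mu_2$ are AGMs that are not TI.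
   Context: The numerical values of $\lambda_{cr}$ given with $\approx$ are approximations to two decimals. Half-tree: let $V$ be the vertex set of the infinite rooted tree with root $x^0$ in which every vertex $x$ has exactly $k$ direct successors, forming the set $S(x)$ (so the root has $k$ nearest neighbours and every other vertex has $k+1$). $W_n$ is the set of vertices at distance $n$ from $x^0$, and $V_n=\bigcup_{j=0}^n W_j$. HC-model (hard-core model): a configuration $\sigma: V\to\{0,1\}$ is admissible if $\sigma(x)\sigma(y)=0$ for all nearest neighbours $x,y$; $\Omega$ (resp. $\Omega_{V_n}$) is the set of admissible configurations on $V$ (resp. $V_n$). For $\sigma_n\in\Omega_{V_n}$, $\#\sigma_n$ is the number of $x\in V_n$ with $\sigma_n(x)=1$. For $\lambda>0$ and a positive function $z: x\mapsto z_x$ on $V$, put $z_{0,x}=1$, $z_{1,x}=z_x$ and $\mu^{(n)}(\sigma_n)=\frac1{Z_n}\lambda^{\#\sigma_n}\prod_{x\in W_n}z_{\sigma_n(x),x}$ on $\Omega_{V_n}$, with $Z_n$ the normalizing constant. If $z_x=\prod_{y\in S(x)}(1+\lambda z_y)^{-1}$ for all $x\in V$, these measures are consistent and define a unique probability measure on $\Omega$ with marginals $\mu^{(n)}$, the (splitting) Gibbs measure corresponding to $z$. It is translation-invariant (a TIGM) if $z_x$ is constant; for each $\lambda>0$ the TIGM exists and is unique. Alternative Gibbs measures (AGM) with parameters $m,r$ ($0\le m,r\le k$ integers): consider functions $z$ taking values in $\{h,l\}$ such that if $z_x=h$ then $z_y=h$ on $m$ vertices $y$ of $S(x)$ and $z_y=l$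 on the remaining $k-m$; and if $z_x=l$ then $z_y=l$ on $r$ vertices $y$ of $S(x)$ and $z_y=h$ on the remaining $k-r$. The arrangement (which vertices get the symbol $h$ and which $l$) is fixed. Such $z$ satisfies the equation above when $h>0$, $l>0$ solve $$h=\frac{1}{(1+\lambda h)^m(1+\lambda l)^{k-m}},\qquad l=\frac{1}{(1+\lambda l)^r(1+\lambda h)^{k-r}}.$$ The AGMs are the Gibbs measures corresponding to the solutions $(h,l)$ of this system, one for each solution; solutions with $h=l$ give the TIGM, and solutions with $h\ne l$ give AGMs which are "not TI".
   Formalization: In items 1 and 3, "exactly three AGMs for λ > λ_cr" fails at λ = 81/32 (item 1) and λ = 16 (item 3), where one non-TI solution merges with the TI one; there the formal statement asserts exactly two AGMs, μ_0 and μ' not TI. *)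

theory Defs
  imports "HOL-Probability.Probability"
begin

(* The half-tree: a vertex is the list of child indices on the path from the root [] to it,
   so its distance from the root is its length. *)

definition tree_V :: "nat \<Rightarrow> nat list set" where
  "tree_V k = {x. set x \<subseteq> {..<k}}"

definition tree_S :: "nat \<Rightarrow> nat list \<Rightarrow> nat list set" where
  "tree_S k x = (\<lambda>i. x @ [i]) ` {..<k}"

definition tree_W :: "nat \<Rightarrow> nat \<Rightarrow> nat list set" where
  "tree_W k n = {x \<in> tree_V k. length x = n}"

definition tree_Vn :: "nat \<Rightarrow> nat \<Rightarrow> nat list set" where
  "tree_Vn k n = (\<Union>j\<le>n. tree_W k j)"

definition nearest_neighbours :: "nat \<Rightarrow> nat list \<Rightarrow> nat list \<Rightarrow> bool" where
  "nearest_neighbours k x y \<longleftrightarrow> y \<in> tree_S k x \<or> x \<in> tree_S k y"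

(* Configurations on a vertex set A are extensional: they are undefined outside A. *)
definition hc_Omega :: "nat \<Rightarrow> nat list set \<Rightarrow> (nat list \<Rightarrow> nat) set" where
  "hc_Omega k A = {\<sigma> \<in> A \<rightarrow>\<^sub>E {0, 1}.
     \<forall>x\<in>A. \<forall>y\<in>A. nearest_neighbours k x y \<longrightarrow> \<sigma> x * \<sigma> y = 0}"

definition hc_algebra :: "nat \<Rightarrow> (nat list \<Rightarrow> nat) measure" where
  "hc_algebra k =
     restrict_space (PiM (tree_V k) (\<lambda>_. count_space {0, 1})) (hc_Omega k (tree_V k))"

definition hc_weight ::
  "nat \<Rightarrow> real \<Rightarrow> (nat list \<Rightarrow> real) \<Rightarrow> nat \<Rightarrow> (nat list \<Rightarrow> nat) \<Rightarrow> real" where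
  "hc_weight k lam z n s =
     lam ^ card {x \<in> tree_Vn k n. s x = 1} * (\<Prod>x\<in>tree_W k n. if s x = 0 then 1 else z x)"

definition hc_mu ::
  "nat \<Rightarrow> real \<Rightarrow> (nat list \<Rightarrow> real) \<Rightarrow> nat \<Rightarrow> (nat list \<Rightarrow> nat) \<Rightarrow> real" where
  "hc_mu k lam z n s =
     hc_weight k lam z n s / (\<Sum>s'\<in>hc_Omega k (tree_Vn k n). hc_weight k lam z n s')"

definition hc_equation :: "nat \<Rightarrow> real \<Rightarrow> (nat list \<Rightarrow> real) \<Rightarrow> bool" where
  "hc_equation k lam z \<longleftrightarrow>
     (\<forall>x\<in>tree_V k. z x > 0 \<and> z x = (\<Prod>y\<in>tree_S k x. inverse (1 + lam * z y)))"

definition hc_gibbs ::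
  "nat \<Rightarrow> real \<Rightarrow> (nat list \<Rightarrow> real) \<Rightarrow> (nat list \<Rightarrow> nat) measure \<Rightarrow> bool" where
  "hc_gibbs k lam z \<mu> \<longleftrightarrow>
     hc_equation k lam z \<and> prob_space \<mu> \<and> sets \<mu> = sets (hc_algebra k) \<and>
     (\<forall>n. \<forall>s\<in>hc_Omega k (tree_Vn k n).
        measure \<mu> {\<sigma> \<in> hc_Omega k (tree_V k). restrict \<sigma> (tree_Vn k n) = s} = hc_mu k lam z n s)"

definition hc_TIGMs :: "nat \<Rightarrow> real \<Rightarrow> (nat list \<Rightarrow> nat) measure set" where
  "hc_TIGMs k lam =
     {\<mu>. \<exists>z. hc_gibbs k lam z \<mu> \<and> (\<forall>x\<in>tree_V k. \<forall>y\<in>tree_V k. z x = z y)}"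

(* The fixed arrangement: the vertices x with "a x" carry the symbol h, the others carry l.
   The symbol at the root is not prescribed. *)
definition hl_arrangement :: "nat \<Rightarrow> nat \<Rightarrow> nat \<Rightarrow> (nat list \<Rightarrow> bool) \<Rightarrow> bool" where
  "hl_arrangement k m r a \<longleftrightarrow>
     (\<forall>x\<in>tree_V k.
        (a x \<longrightarrow> card {y \<in> tree_S k x. a y} = m \<and> card {y \<in> tree_S k x. \<not> a y} = k - m) \<and>
        (\<not> a x \<longrightarrow> card {y \<in> tree_S k x. \<not> a y} = r \<and> card {y \<in> tree_S k x. a y} = k - r))"

definition hl_system :: "nat \<Rightarrow> real \<Rightarrow> nat \<Rightarrow> nat \<Rightarrow> real \<Rightarrow> real \<Rightarrow> bool" where
  "hl_system k lam m r h l \<longleftrightarrow>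
     h > 0 \<and> l > 0 \<and>
     h = 1 / ((1 + lam * h) ^ m * (1 + lam * l) ^ (k - m)) \<and>
     l = 1 / ((1 + lam * l) ^ r * (1 + lam * h) ^ (k - r))"

definition hc_AGMs ::
  "nat \<Rightarrow> real \<Rightarrow> nat \<Rightarrow> nat \<Rightarrow> (nat list \<Rightarrow> bool) \<Rightarrow> (nat list \<Rightarrow> nat) measure set" where
  "hc_AGMs k lam m r a =
     {\<mu>. \<exists>h l. hl_system k lam m r h l \<and> hc_gibbs k lam (\<lambda>x. if a x then h else l) \<mu>}"

(* Pitfall for k = 4 and m \<noteq> r: the curve of solutions with h \<noteq> l, continued to h = l, meets
   the constant solution at lam * h = lam * l = 1/2, lam = 81/32 if m + r = 1, and at
   lam * h = lam * l = 1, lam = 16 if m + r = 2.  These parameters exceed the critical one, and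
   there one of the two solutions with h \<noteq> l has merged with the constant solution, so only
   one AGM that is not translation-invariant is left. *)

end

theory Submission
  imports Defs "HOL-Real_Asymp.Real_Asymp"
begin

text \<open>
  The theorem reduces to counting the solutions \<open>(h, l)\<close> of the two-variable system.

  Each solution \<open>z\<close> of the equation on the tree carries exactly one Gibbs measure. It exists because the required
  marginals are those of a Markov chain from the root to the leaves, which can be built from independent coins
  (\<open>hc_gibbs_exists\<close>); it is unique because cylinder events generate the \<open>\<sigma>\<close>-algebra (\<open>hc_gibbs_unique\<close>). Conversely
  the measure determines \<open>z\<close> on the tree through a ratio of two cylinder probabilities (\<open>hc_gibbs_determines_z\<close>).
  Since both symbols occur in every arrangement with \<open>m, r < k\<close>, distinct solutions \<open>(h, l)\<close> give distinct measures,
  and the measure is translation-invariant exactly if \<open>h = l\<close>. On the diagonal the system becomes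
  \<open>h (1 + \<lambda>h)\<^sup>k = 1\<close>, which has one positive solution. All this is collected in \<open>AGM_classification\<close>.

  For \<open>k = 4\<close> the solutions off the diagonal form a rational curve with a parameter \<open>t > 0\<close>, on which \<open>\<lambda>\<close> is a
  function of \<open>t\<close>, and \<open>t = 1\<close> is the point where the curve meets the diagonal:
  \<^item> \<open>m = 1\<close>, \<open>r = 0\<close>: \<open>\<lambda> = (1 + t + t\<^sup>2)\<^sup>4 / (t (1 + t)\<^sup>5)\<close> with \<open>t = (1 + \<lambda>h) / (1 + \<lambda>l)\<close>;
  \<^item> \<open>m = 1\<close>, \<open>r = 1\<close>: \<open>\<lambda> = (1 + t)\<^sup>4 / t\<^sup>2\<close> with \<open>t = \<lambda>h = 1 / (\<lambda>l)\<close>;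
  \<^item> \<open>m = 2\<close>, \<open>r = 0\<close>: \<open>\<lambda> = (1 + t)\<^sup>4 / t\<close> with \<open>t = \<lambda>h = 1 / (\<lambda>l)\<close>.

  The cases with \<open>m\<close> and \<open>r\<close> exchanged follow by exchanging \<open>h\<close> and \<open>l\<close>. Each of these functions tends to infinity
  at both ends of the positive axis and has a single critical point, its minimum (\<open>level_sets_of_unimodal\<close>). The
  minimal value is the critical activity: below it there is no solution off the diagonal, above it there are two. In the second case the
  minimum is at \<open>t = 1\<close>, so nothing new exists at \<open>\<lambda> = 16\<close> itself. In the other cases the minimum is at some
  \<open>t < 1\<close>: the critical value gives one new measure, and at the larger value \<open>\<lambda>\<close> that belongs to \<open>t = 1\<close> one of the
  two new solutions coincides with the diagonal one. The critical points are the positive root of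
  \<open>2t\<^sup>3 + 5t\<^sup>2 - 3t - 1\<close>, approximately 0.6948, with value approximately 2.314, and \<open>t = 1/3\<close> with value
  \<open>256/27\<close>.
\<close>

section \<open>The tree and its admissible configurations\<close>
lemma mem_tree_Vn: "x \<in> tree_Vn k n \<longleftrightarrow> x \<in> tree_V k \<and> length x \<le> n"
  by (auto simp: tree_Vn_def tree_W_def)

lemma finite_tree_Vn: "finite (tree_Vn k n)"
  unfolding tree_Vn_def tree_W_def tree_V_def by (auto simp: finite_lists_length_eq)

lemma finite_tree_W: "finite (tree_W k n)"
  unfolding tree_W_def tree_V_def by (auto simp: finite_lists_length_eq)

lemma Nil_in_tree_V [simp]: "[] \<in> tree_V k"
  by (simp add: tree_V_def)

lemma butlast_in_tree_V: "x \<in> tree_V k \<Longrightarrow> butlast x \<in> tree_V k"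
  by (auto simp: tree_V_def dest: in_set_butlastD)

lemma tree_S_iff: "x \<in> tree_V k \<Longrightarrow> y \<in> tree_S k x \<longleftrightarrow> y \<in> tree_V k \<and> y \<noteq> [] \<and> butlast y = x"
  by (cases y rule: rev_cases) (auto simp: tree_S_def tree_V_def)

lemma card_tree_S: "card (tree_S k x) = k"
  unfolding tree_S_def by (subst card_image) (auto simp: inj_on_def)

lemma finite_tree_S [simp]: "finite (tree_S k x)"
  by (simp add: tree_S_def)

text \<open>Every edge joins a vertex to its parent, which for a nonempty path is its \<^const>\<open>butlast\<close>.
  Admissibility is therefore a condition on parents only, the form in which a recursion from the root can verify
  it.\<close>
lemma hc_Omega_iff:
  assumes "A \<subseteq> tree_V k"
  shows "s \<in> hc_Omega k A \<longleftrightarrow> s \<in> A \<rightarrow>\<^sub>E {0, 1} \<and>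
    (\<forall>y\<in>A. y \<noteq> [] \<longrightarrow> butlast y \<in> A \<longrightarrow> s y = 1 \<longrightarrow> s (butlast y) = 0)" (is "_ \<longleftrightarrow> ?E \<and> ?R")
proof (intro iffI conjI)
  assume s: "s \<in> hc_Omega k A"
  show ?E using s by (simp add: hc_Omega_def)
  show ?R
  proof (intro ballI impI)
    fix y assume y: "y \<in> A" "y \<noteq> []" "butlast y \<in> A" "s y = 1"
    then have "nearest_neighbours k (butlast y) y"
      using assms unfolding nearest_neighbours_def by (subst tree_S_iff) auto
    with s y have "s (butlast y) * s y = 0" unfolding hc_Omega_def by blast
    with y show "s (butlast y) = 0" by simp
  qed
next
  assume s: "?E \<and> ?R"
  have "s x * s y = 0" if xy: "x \<in> A" "y \<in> A" "y \<in> tree_S k x" for x y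
  proof -
    have "x \<in> tree_V k" using xy assms by auto
    then have "y \<noteq> []" "butlast y = x" using tree_S_iff xy by auto
    moreover have "s y = 0 \<or> s y = 1" using s xy by auto
    ultimately show ?thesis using s xy by auto
  qed
  then have "\<forall>x\<in>A. \<forall>y\<in>A. nearest_neighbours k x y \<longrightarrow> s x * s y = 0"
    unfolding nearest_neighbours_def by (metis mult.commute)
  then show "s \<in> hc_Omega k A" using s unfolding hc_Omega_def by blast
qed

lemma hc_Omega_V_iff: "s \<in> hc_Omega k (tree_V k) \<longleftrightarrow> s \<in> tree_V k \<rightarrow>\<^sub>E {0, 1} \<and>
    (\<forall>y\<in>tree_V k. y \<noteq> [] \<longrightarrow> s y = 1 \<longrightarrow> s (butlast y) = 0)"
  by (subst hc_Omega_iff) (auto simp: butlast_in_tree_V)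

lemma hc_Omega_Vn_iff: "s \<in> hc_Omega k (tree_Vn k n) \<longleftrightarrow> s \<in> tree_Vn k n \<rightarrow>\<^sub>E {0, 1} \<and>
    (\<forall>y\<in>tree_Vn k n. y \<noteq> [] \<longrightarrow> s y = 1 \<longrightarrow> s (butlast y) = 0)"
  by (subst hc_Omega_iff) (auto simp: butlast_in_tree_V mem_tree_Vn)

lemma finite_Omega_Vn: "finite (hc_Omega k (tree_Vn k n))"
  by (rule finite_subset[of _ "tree_Vn k n \<rightarrow>\<^sub>E {0, 1}"])
     (auto simp: hc_Omega_def finite_tree_Vn intro!: finite_PiE)

lemma restrict_Omega:
  "s \<in> hc_Omega k (tree_V k) \<Longrightarrow> restrict s (tree_Vn k n) \<in> hc_Omega k (tree_Vn k n)"
  unfolding hc_Omega_Vn_iff hc_Omega_V_iff by (auto simp: mem_tree_Vn butlast_in_tree_V Pi_iff PiE_iff)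

lemma space_hc_algebra [simp]: "space (hc_algebra k) = hc_Omega k (tree_V k)"
  by (auto simp: hc_algebra_def space_restrict_space space_PiM hc_Omega_def)

section \<open>Cylinder events determine the measure\<close>
lemma measurable_site:
  assumes "x \<in> tree_V k"
  shows "(\<lambda>\<sigma>. \<sigma> x) \<in> measurable (hc_algebra k) (count_space {0, 1})"
  unfolding hc_algebra_def
  by (intro measurable_restrict_space1 measurable_component_singleton assms)

lemma sets_cylinder:
  "{\<sigma> \<in> hc_Omega k (tree_V k). restrict \<sigma> (tree_Vn k n) = s} \<in> sets (hc_algebra k)"
proof (cases "s \<in> extensional (tree_Vn k n)")
  case True
  have "Measurable.pred (hc_algebra k) (\<lambda>\<sigma>. \<forall>x\<in>tree_Vn k n. \<sigma> x = s x)"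
  proof (intro pred_intros_finite finite_tree_Vn)
    fix x assume "x \<in> tree_Vn k n"
    then have m: "(\<lambda>\<sigma>. \<sigma> x) \<in> measurable (hc_algebra k) (count_space {0, 1})"
      by (intro measurable_site) (simp add: mem_tree_Vn)
    show "Measurable.pred (hc_algebra k) (\<lambda>\<sigma>. \<sigma> x = s x)"
      using measurable_compose[OF m, of "\<lambda>v. v = s x" "count_space UNIV"] by simp
  qed
  then have "{\<sigma> \<in> space (hc_algebra k). \<forall>x\<in>tree_Vn k n. \<sigma> x = s x} \<in> sets (hc_algebra k)"
    by measurable
  also have "{\<sigma> \<in> space (hc_algebra k). \<forall>x\<in>tree_Vn k n. \<sigma> x = s x} =
    {\<sigma> \<in> hc_Omega k (tree_V k). restrict \<sigma> (tree_Vn k n) = s}"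
    using True by (auto simp: fun_eq_iff extensional_def restrict_def)
  finally show ?thesis .
next
  case False
  then have "{\<sigma> \<in> hc_Omega k (tree_V k). restrict \<sigma> (tree_Vn k n) = s} = {}" by auto
  then show ?thesis by (metis sets.empty_sets)
qed

text \<open>Events that depend on a finite part \<^term>\<open>tree_Vn k n\<close> of the tree. Letting \<open>T\<close> be a set of configurations
  instead of a single one makes the family closed under intersection.\<close>
definition cylinders :: "nat \<Rightarrow> (nat list \<Rightarrow> nat) set set" where
  "cylinders k = {{\<sigma> \<in> hc_Omega k (tree_V k). restrict \<sigma> (tree_Vn k n) \<in> T} |
     n T. T \<subseteq> hc_Omega k (tree_Vn k n)}"

lemma cylinderI:
  "{\<sigma> \<in> hc_Omega k (tree_V k). restrict \<sigma> (tree_Vn k n) \<in> T} \<in> cylinders k"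
proof -
  have "{\<sigma> \<in> hc_Omega k (tree_V k). restrict \<sigma> (tree_Vn k n) \<in> T} =
    {\<sigma> \<in> hc_Omega k (tree_V k). restrict \<sigma> (tree_Vn k n) \<in> T \<inter> hc_Omega k (tree_Vn k n)}"
    using restrict_Omega by auto
  then show ?thesis unfolding cylinders_def by blast
qed

lemma cylinder_at_larger_depth:
  assumes "n \<le> n'"
  shows "\<exists>T'. {\<sigma> \<in> hc_Omega k (tree_V k). restrict \<sigma> (tree_Vn k n) \<in> T} =
    {\<sigma> \<in> hc_Omega k (tree_V k). restrict \<sigma> (tree_Vn k n') \<in> T'}"
proof -
  have "tree_Vn k n' \<inter> tree_Vn k n = tree_Vn k n" using assms by (auto simp: mem_tree_Vn)
  then have "restrict (restrict \<sigma> (tree_Vn k n')) (tree_Vn k n) = restrict \<sigma> (tree_Vn k n)"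
    for \<sigma> :: "nat list \<Rightarrow> nat" by (simp add: restrict_restrict)
  then show ?thesis
    by (intro exI[of _ "{s. restrict s (tree_Vn k n) \<in> T}"]) simp
qed

lemma Int_stable_cylinders: "Int_stable (cylinders k)"
proof (rule Int_stableI)
  fix A B assume "A \<in> cylinders k" "B \<in> cylinders k"
  then obtain n T n' T' where
    A: "A = {\<sigma> \<in> hc_Omega k (tree_V k). restrict \<sigma> (tree_Vn k n) \<in> T}" and
    B: "B = {\<sigma> \<in> hc_Omega k (tree_V k). restrict \<sigma> (tree_Vn k n') \<in> T'}"
    unfolding cylinders_def by blast
  obtain U U' where
    "A = {\<sigma> \<in> hc_Omega k (tree_V k). restrict \<sigma> (tree_Vn k (max n n')) \<in> U}"
    "B = {\<sigma> \<in> hc_Omega k (tree_V k). restrict \<sigma> (tree_Vn k (max n n')) \<in> U'}"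
    using cylinder_at_larger_depth[of n "max n n'" k T] cylinder_at_larger_depth[of n' "max n n'" k T'] A B by auto
  then have "A \<inter> B = {\<sigma> \<in> hc_Omega k (tree_V k). restrict \<sigma> (tree_Vn k (max n n')) \<in> U \<inter> U'}"
    by auto
  then show "A \<inter> B \<in> cylinders k" by (simp only: cylinderI)
qed

text \<open>The value at a single vertex \<open>x\<close> is a cylinder event of depth \<^term>\<open>length x\<close>, so the identity map is measurable
  from the \<open>\<sigma>\<close>-algebra of cylinders to the trace of the product \<open>\<sigma>\<close>-algebra; conversely a cylinder is a finite
  union of events prescribing finitely many values.\<close>
lemma sets_hc_algebra: "sets (hc_algebra k) = sigma_sets (hc_Omega k (tree_V k)) (cylinders k)"
proof
  let ?\<Omega> = "hc_Omega k (tree_V k)"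
  have sub: "cylinders k \<subseteq> Pow ?\<Omega>" by (auto simp: cylinders_def)
  show "sigma_sets ?\<Omega> (cylinders k) \<subseteq> sets (hc_algebra k)"
  proof -
    have "C \<in> sets (hc_algebra k)" if C: "C \<in> cylinders k" for C
    proof -
      obtain n T where T: "T \<subseteq> hc_Omega k (tree_Vn k n)"
        and "C = {\<sigma> \<in> ?\<Omega>. restrict \<sigma> (tree_Vn k n) \<in> T}"
        using C unfolding cylinders_def by blast
      then have "C = (\<Union>s\<in>T. {\<sigma> \<in> ?\<Omega>. restrict \<sigma> (tree_Vn k n) = s})" by auto
      moreover have "finite T" using T finite_Omega_Vn finite_subset by blast
      ultimately show ?thesis using sets_cylinder by auto
    qed
    then show ?thesis
      using sets.sigma_sets_subset[of "cylinders k" "hc_algebra k"] by auto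
  qed
  show "sets (hc_algebra k) \<subseteq> sigma_sets ?\<Omega> (cylinders k)"
  proof -
    let ?S = "sigma ?\<Omega> (cylinders k)"
    have spS: "space ?S = ?\<Omega>" using sub by simp
    have "(\<lambda>\<sigma> x. \<sigma> x) \<in> measurable ?S (PiM (tree_V k) (\<lambda>_. count_space {0, 1}))"
    proof (rule measurable_PiM_single')
      fix x assume x: "x \<in> tree_V k"
      show "(\<lambda>\<sigma>. \<sigma> x) \<in> measurable ?S (count_space {0, 1})"
      proof (rule measurableI)
        fix \<sigma> assume "\<sigma> \<in> space ?S"
        then show "\<sigma> x \<in> space (count_space {0, 1})"
          using x by (auto simp: spS hc_Omega_V_iff)
      next
        fix A assume "A \<in> sets (count_space {0, 1 :: nat})"
        have "(\<lambda>\<sigma>. \<sigma> x) -` A \<inter> ?\<Omega> =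
          {\<sigma> \<in> ?\<Omega>. restrict \<sigma> (tree_Vn k (length x)) \<in> {s. s x \<in> A}}"
          using x by (auto simp: mem_tree_Vn)
        also have "\<dots> \<in> cylinders k" by (rule cylinderI)
        finally show "(\<lambda>\<sigma>. \<sigma> x) -` A \<inter> space ?S \<in> sets ?S"
          using sub by (simp add: spS)
      qed
    next
      show "(\<lambda>\<sigma> x. \<sigma> x) \<in> space ?S \<rightarrow> (\<Pi>\<^sub>E x\<in>tree_V k. space (count_space {0, 1}))"
        unfolding spS by (auto simp: hc_Omega_V_iff)
    qed
    then have m: "(\<lambda>\<sigma>. \<sigma>) \<in> measurable ?S (hc_algebra k)"
      unfolding hc_algebra_def by (intro measurable_restrict_space2) (auto simp: spS)
    show ?thesis
    proof
      fix A assume A: "A \<in> sets (hc_algebra k)"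
      then have "A \<subseteq> ?\<Omega>" using sets.sets_into_space by fastforce
      with measurable_sets[OF m A] sub show "A \<in> sigma_sets ?\<Omega> (cylinders k)"
        by (simp add: Int_absorb2)
    qed
  qed
qed

lemma measure_eqI_cylinders:
  assumes "prob_space M" "prob_space N"
    and sets: "sets M = sets (hc_algebra k)" "sets N = sets (hc_algebra k)"
    and eq: "\<And>n s. s \<in> hc_Omega k (tree_Vn k n) \<Longrightarrow>
      measure M {\<sigma> \<in> hc_Omega k (tree_V k). restrict \<sigma> (tree_Vn k n) = s} =
      measure N {\<sigma> \<in> hc_Omega k (tree_V k). restrict \<sigma> (tree_Vn k n) = s}"
  shows "M = N"
proof (rule measure_eqI_generator_eq[OF Int_stable_cylinders[of k]])
  interpret M: prob_space M by fact
  interpret N: prob_space N by fact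
  let ?\<Omega> = "hc_Omega k (tree_V k)"
  show "cylinders k \<subseteq> Pow ?\<Omega>" by (auto simp: cylinders_def)
  show "sets M = sigma_sets ?\<Omega> (cylinders k)" "sets N = sigma_sets ?\<Omega> (cylinders k)"
    using sets sets_hc_algebra by auto
  have "?\<Omega> \<in> cylinders k" using cylinderI[of k 0 UNIV] by simp
  then show "range (\<lambda>i::nat. ?\<Omega>) \<subseteq> cylinders k" by auto
  show "(\<Union>i::nat. ?\<Omega>) = ?\<Omega>" by simp
  show "emeasure M ?\<Omega> \<noteq> \<infinity>" by simp
  fix C assume "C \<in> cylinders k"
  then obtain n T where T: "T \<subseteq> hc_Omega k (tree_Vn k n)"
    and "C = {\<sigma> \<in> ?\<Omega>. restrict \<sigma> (tree_Vn k n) \<in> T}"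
    unfolding cylinders_def by blast
  then have C: "C = (\<Union>s\<in>T. {\<sigma> \<in> ?\<Omega>. restrict \<sigma> (tree_Vn k n) = s})" by auto
  have fin: "finite T" using T finite_Omega_Vn finite_subset by blast
  have disj: "disjoint_family_on (\<lambda>s. {\<sigma> \<in> ?\<Omega>. restrict \<sigma> (tree_Vn k n) = s}) T"
    by (auto simp: disjoint_family_on_def)
  have "measure M C = (\<Sum>s\<in>T. measure M {\<sigma> \<in> ?\<Omega>. restrict \<sigma> (tree_Vn k n) = s})"
    unfolding C using fin disj
    by (intro M.finite_measure_finite_Union) (auto simp: sets intro: sets_cylinder)
  also have "\<dots> = (\<Sum>s\<in>T. measure N {\<sigma> \<in> ?\<Omega>. restrict \<sigma> (tree_Vn k n) = s})"
    using T eq by (intro sum.cong) auto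
  also have "\<dots> = measure N C"
    unfolding C using fin disj
    by (intro N.finite_measure_finite_Union[symmetric]) (auto simp: sets intro: sets_cylinder)
  finally show "emeasure M C = emeasure N C"
    by (simp add: M.emeasure_eq_measure N.emeasure_eq_measure)
qed

lemma hc_gibbs_unique:
  assumes "hc_gibbs k lam z M" "hc_gibbs k lam z N"
  shows "M = N"
  using assms by (intro measure_eqI_cylinders[of M N k]) (auto simp: hc_gibbs_def)

section \<open>Construction of the Gibbs measure from independent coins\<close>

text \<open>Under a Gibbs measure the configuration is a Markov chain running from the root to the leaves: a vertex
  with an empty parent is occupied with probability \<open>\<lambda>z\<^sub>x / (1 + \<lambda>z\<^sub>x)\<close>, and a vertex with an occupied parent is
  empty. Attaching one coin to each vertex realises this chain as a measurable image of a product measure.\<close>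
function occupied :: "(nat list \<Rightarrow> bool) \<Rightarrow> nat list \<Rightarrow> bool" where
  "occupied B x \<longleftrightarrow> B x \<and> (x \<noteq> [] \<longrightarrow> \<not> occupied B (butlast x))"
  by auto
termination by (relation "inv_image less_than (\<lambda>(B, x). length x)") auto

declare occupied.simps [simp del]

definition coin_bias :: "real \<Rightarrow> (nat list \<Rightarrow> real) \<Rightarrow> nat list \<Rightarrow> real" where
  "coin_bias lam z x = lam * z x / (1 + lam * z x)"

definition coins :: "nat \<Rightarrow> real \<Rightarrow> (nat list \<Rightarrow> real) \<Rightarrow> (nat list \<Rightarrow> bool) measure" where
  "coins k lam z = PiM (tree_V k) (\<lambda>x. measure_pmf (bernoulli_pmf (coin_bias lam z x)))"

definition occupation :: "nat \<Rightarrow> (nat list \<Rightarrow> bool) \<Rightarrow> nat list \<Rightarrow> nat" where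
  "occupation k B = (\<lambda>x\<in>tree_V k. if occupied B x then 1 else 0)"

lemma occupation_in_Omega: "occupation k B \<in> hc_Omega k (tree_V k)"
  unfolding hc_Omega_V_iff
proof (intro conjI ballI impI)
  fix y assume "y \<in> tree_V k" "y \<noteq> []" "occupation k B y = 1"
  then show "occupation k B (butlast y) = 0"
    using occupied.simps[of B y] butlast_in_tree_V[of y k]
    by (auto simp: occupation_def split: if_splits)
qed (auto simp: occupation_def)

lemma pred_occupied:
  "x \<in> tree_V k \<Longrightarrow> Measurable.pred (coins k lam z) (\<lambda>B. occupied B x)"
proof (induction x rule: length_induct)
  case (1 x)
  have coin: "Measurable.pred (coins k lam z) (\<lambda>B. B x)"
  proof -
    have m: "(\<lambda>B. B x) \<in> measurable (coins k lam z)
      (measure_pmf (bernoulli_pmf (coin_bias lam z x)))"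
      unfolding coins_def by (rule measurable_component_singleton) (rule 1(2))
    show ?thesis using measurable_compose[OF m, of "\<lambda>b. b" "count_space UNIV"] by simp
  qed
  show ?case
  proof (cases "x = []")
    case True
    then have "(\<lambda>B. occupied B x) = (\<lambda>B. B x)" by (intro ext, subst occupied.simps) simp
    with coin show ?thesis by simp
  next
    case False
    have "Measurable.pred (coins k lam z) (\<lambda>B. occupied B (butlast x))"
      using 1 False butlast_in_tree_V[of x k] by simp
    with coin have "Measurable.pred (coins k lam z) (\<lambda>B. B x \<and> \<not> occupied B (butlast x))"
      by measurable
    moreover have "(\<lambda>B. occupied B x) = (\<lambda>B. B x \<and> \<not> occupied B (butlast x))"
      using False by (intro ext, subst occupied.simps) simp
    ultimately show ?thesis by simp
  qed
qed

lemma measurable_occupation: "occupation k \<in> measurable (coins k lam z) (hc_algebra k)"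
  unfolding hc_algebra_def
proof (rule measurable_restrict_space2)
  show "occupation k \<in> space (coins k lam z) \<rightarrow> hc_Omega k (tree_V k)"
    using occupation_in_Omega by auto
  have "(\<lambda>B x. occupation k B x) \<in>
    measurable (coins k lam z) (PiM (tree_V k) (\<lambda>_. count_space {0, 1}))"
  proof (rule measurable_PiM_single')
    fix x assume x: "x \<in> tree_V k"
    note [measurable] = pred_occupied[OF x, of lam z]
    show "(\<lambda>B. occupation k B x) \<in> measurable (coins k lam z) (count_space {0, 1})"
      using x unfolding occupation_def by simp
  qed (auto simp: occupation_def split: if_splits)
  then show "occupation k \<in> measurable (coins k lam z) (PiM (tree_V k) (\<lambda>_. count_space {0, 1}))"
    by simp
qed

text \<open>The vertices whose coin decides their value: all others are forced to be empty by an occupied parent.\<close>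
definition free_sites :: "nat \<Rightarrow> nat \<Rightarrow> (nat list \<Rightarrow> nat) \<Rightarrow> nat list set" where
  "free_sites k n s = {x \<in> tree_Vn k n. x = [] \<or> s (butlast x) = 0}"

lemma occupation_restrict_iff:
  assumes s: "s \<in> hc_Omega k (tree_Vn k n)"
  shows "restrict (occupation k B) (tree_Vn k n) = s \<longleftrightarrow>
    (\<forall>x\<in>free_sites k n s. B x \<longleftrightarrow> s x = 1)" (is "?L \<longleftrightarrow> ?R")
proof -
  have s01: "s x = 0 \<or> s x = 1" if "x \<in> tree_Vn k n" for x
    using s that by (auto simp: hc_Omega_Vn_iff)
  have sext: "s \<in> extensional (tree_Vn k n)" using s by (auto simp: hc_Omega_Vn_iff PiE_def)
  have up: "butlast x \<in> tree_Vn k n" if "x \<in> tree_Vn k n" for x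
    using that butlast_in_tree_V by (auto simp: mem_tree_Vn)
  have "?L \<longleftrightarrow> (\<forall>x\<in>tree_Vn k n. occupation k B x = s x)"
    using sext by (auto simp: fun_eq_iff extensional_def restrict_def)
  also have "\<dots> \<longleftrightarrow> (\<forall>x\<in>tree_Vn k n. occupied B x \<longleftrightarrow> s x = 1)"
    using s01 by (intro ball_cong) (force simp: occupation_def mem_tree_Vn)+
  also have "\<dots> \<longleftrightarrow> ?R"
  proof
    assume L: "\<forall>x\<in>tree_Vn k n. occupied B x \<longleftrightarrow> s x = 1"
    show ?R
    proof
      fix x assume "x \<in> free_sites k n s"
      then have x: "x \<in> tree_Vn k n" "x = [] \<or> s (butlast x) = 0"
        by (auto simp: free_sites_def)
      then have "x \<noteq> [] \<longrightarrow> \<not> occupied B (butlast x)" using L up by auto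
      then show "B x \<longleftrightarrow> s x = 1" using L x occupied.simps[of B x] by blast
    qed
  next
    assume R: ?R
    have "x \<in> tree_Vn k n \<Longrightarrow> occupied B x \<longleftrightarrow> s x = 1" for x
    proof (induction x rule: length_induct)
      case (1 x)
      have parent: "occupied B (butlast x) \<longleftrightarrow> s (butlast x) = 1" if "x \<noteq> []"
        using 1 up[of x] that by simp
      show ?case
      proof (cases "x \<in> free_sites k n s")
        case True
        then show ?thesis
          using R parent occupied.simps[of B x] by (auto simp: free_sites_def)
      next
        case False
        then have "x \<noteq> []" "s (butlast x) = 1"
          using 1(2) s01[OF up[of x]] by (auto simp: free_sites_def)
        moreover from this have "s x \<noteq> 1" using s 1(2) by (auto simp: hc_Omega_Vn_iff)
        ultimately show ?thesis using parent occupied.simps[of B x] by auto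
      qed
    qed
    then show "\<forall>x\<in>tree_Vn k n. occupied B x \<longleftrightarrow> s x = 1" by blast
  qed
  finally show ?thesis .
qed

lemma hc_equation_pos: "hc_equation k lam z \<Longrightarrow> x \<in> tree_V k \<Longrightarrow> z x > 0"
  unfolding hc_equation_def by blast

lemma coin_bias_bounds:
  assumes "lam > 0" "z x > 0"
  shows "0 \<le> coin_bias lam z x" "coin_bias lam z x \<le> 1"
    "1 - coin_bias lam z x = 1 / (1 + lam * z x)"
proof -
  have "lam * z x > 0" using assms by simp
  then show "0 \<le> coin_bias lam z x" "coin_bias lam z x \<le> 1"
    "1 - coin_bias lam z x = 1 / (1 + lam * z x)"
    by (auto simp: coin_bias_def field_simps)
qed

text \<open>A cylinder prescribes exactly the coins at its free sites, so its probability factorizes.\<close>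
lemma measure_coins_cylinder:
  assumes lam: "lam > 0" and z: "hc_equation k lam z" and s: "s \<in> hc_Omega k (tree_Vn k n)"
  shows "measure (distr (coins k lam z) (hc_algebra k) (occupation k))
      {\<sigma> \<in> hc_Omega k (tree_V k). restrict \<sigma> (tree_Vn k n) = s} =
    (\<Prod>x\<in>free_sites k n s. (if s x = 1 then lam * z x else 1) / (1 + lam * z x))"
proof -
  let ?M = "\<lambda>x. measure_pmf (bernoulli_pmf (coin_bias lam z x))"
  let ?J = "free_sites k n s"
  interpret product_prob_space ?M "tree_V k"
    by unfold_locales
  have J: "?J \<subseteq> tree_V k" by (auto simp: free_sites_def mem_tree_Vn)
  have finJ: "finite ?J" using finite_tree_Vn by (simp add: free_sites_def)
  have "measure (distr (coins k lam z) (hc_algebra k) (occupation k))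
      {\<sigma> \<in> hc_Omega k (tree_V k). restrict \<sigma> (tree_Vn k n) = s} =
    measure (coins k lam z) (occupation k -`
      {\<sigma> \<in> hc_Omega k (tree_V k). restrict \<sigma> (tree_Vn k n) = s} \<inter> space (coins k lam z))"
    by (intro measure_distr measurable_occupation sets_cylinder)
  also have "occupation k -`
      {\<sigma> \<in> hc_Omega k (tree_V k). restrict \<sigma> (tree_Vn k n) = s} \<inter> space (coins k lam z) =
    prod_emb (tree_V k) ?M ?J (\<Pi>\<^sub>E x\<in>?J. {s x = 1})"
    using J occupation_in_Omega
    by (auto simp: occupation_restrict_iff[OF s] prod_emb_def coins_def space_PiM PiE_iff)
  also have "measure (coins k lam z) \<dots> = (\<Prod>x\<in>?J. measure (?M x) {s x = 1})"
    unfolding coins_def by (rule measure_PiM_emb) (use J finJ in auto)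
  also have "\<dots> = (\<Prod>x\<in>?J. (if s x = 1 then lam * z x else 1) / (1 + lam * z x))"
  proof (rule prod.cong)
    fix x assume "x \<in> ?J"
    then have "z x > 0" using J z hc_equation_pos by blast
    from coin_bias_bounds[of lam z x, OF lam this]
    show "measure (?M x) {s x = 1} = (if s x = 1 then lam * z x else 1) / (1 + lam * z x)"
      by (simp add: measure_pmf_single) (simp add: coin_bias_def)
  qed simp
  finally show ?thesis .
qed

text \<open>The free sites are the root and the children of the empty vertices \<open>w\<close> above the last layer. By the equation for
  \<open>z\<close> the denominators belonging to the children of \<open>w\<close> multiply to \<open>z\<^sub>w\<close>. Completing the product over the empty
  interior vertices to one over all interior vertices, a constant, moves the missing factors \<open>z\<^sub>w\<close> into the
  denominator, where they cancel the factors of the occupied interior vertices. Only those of the last layer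
  survive.\<close>
lemma cylinder_product_eq_weight:
  assumes lam: "lam > 0" and z: "hc_equation k lam z" and s: "s \<in> hc_Omega k (tree_Vn k n)"
  shows "(\<Prod>x\<in>free_sites k n s. (if s x = 1 then lam * z x else 1) / (1 + lam * z x)) =
    (\<Prod>x\<in>tree_Vn k n - tree_W k n. z x) / (1 + lam * z []) * hc_weight k lam z n s"
proof -
  let ?V = "tree_Vn k n" and ?J = "free_sites k n s"
  let ?I = "tree_Vn k n - tree_W k n" and ?O = "{x \<in> tree_Vn k n. s x = 1}"
  have fin: "finite ?V" "finite ?J" "finite ?I" "finite ?O"
    using finite_tree_Vn by (auto simp: free_sites_def)
  have pos: "z x > 0" if "x \<in> ?V" for x using that z hc_equation_pos by (auto simp: mem_tree_Vn)
  have s01: "s x = 0 \<or> s x = 1" if "x \<in> ?V" for x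
    using s that by (auto simp: hc_Omega_Vn_iff)
  have I: "?I = {x \<in> tree_V k. length x < n}" by (auto simp: mem_tree_Vn tree_W_def)
  have OJ: "?O = {x \<in> ?J. s x = 1}" using s by (auto simp: free_sites_def hc_Omega_Vn_iff)
  have num: "(\<Prod>x\<in>?J. if s x = 1 then lam * z x else 1) = lam ^ card ?O * (\<Prod>x\<in>?O. z x)"
    unfolding OJ using fin by (subst prod.inter_filter[symmetric]) (auto simp: prod.distrib)
  have Jsplit: "?J = insert [] (\<Union>w\<in>{w \<in> ?I. s w = 0}. tree_S k w)"
  proof (rule set_eqI)
    fix y
    show "y \<in> ?J \<longleftrightarrow> y \<in> insert [] (\<Union>w\<in>{w \<in> ?I. s w = 0}. tree_S k w)"
    proof (cases y rule: rev_cases)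
      case Nil
      then show ?thesis by (simp add: free_sites_def mem_tree_Vn)
    next
      case (snoc w i)
      then show ?thesis unfolding free_sites_def I
        by (fastforce simp: mem_tree_Vn tree_S_def tree_V_def)
    qed
  qed
  have den: "(\<Prod>x\<in>?J. 1 / (1 + lam * z x)) = 1 / (1 + lam * z []) * (\<Prod>w\<in>{w \<in> ?I. s w = 0}. z w)"
  proof -
    have "(\<Prod>x\<in>?J. 1 / (1 + lam * z x)) = 1 / (1 + lam * z []) *
      (\<Prod>x\<in>(\<Union>w\<in>{w \<in> ?I. s w = 0}. tree_S k w). 1 / (1 + lam * z x))"
      unfolding Jsplit using fin by (subst prod.insert) (auto simp: tree_S_def)
    also have "(\<Prod>x\<in>(\<Union>w\<in>{w \<in> ?I. s w = 0}. tree_S k w). 1 / (1 + lam * z x)) =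
      (\<Prod>w\<in>{w \<in> ?I. s w = 0}. \<Prod>x\<in>tree_S k w. 1 / (1 + lam * z x))"
      using fin by (intro prod.UNION_disjoint) (auto simp: tree_S_def)
    also have "\<dots> = (\<Prod>w\<in>{w \<in> ?I. s w = 0}. z w)"
      using z by (intro prod.cong) (auto simp: hc_equation_def I inverse_eq_divide)
    finally show ?thesis .
  qed
  have split: "(\<Prod>w\<in>?I. z w) = (\<Prod>w\<in>{w \<in> ?I. s w = 0}. z w) * (\<Prod>w\<in>{w \<in> ?I. s w = 1}. z w)"
  proof -
    have "?I = {w \<in> ?I. s w = 0} \<union> {w \<in> ?I. s w = 1}" using s01 by blast
    then have "(\<Prod>w\<in>?I. z w) = (\<Prod>w\<in>{w \<in> ?I. s w = 0} \<union> {w \<in> ?I. s w = 1}. z w)"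
      by (rule arg_cong)
    also have "\<dots> = (\<Prod>w\<in>{w \<in> ?I. s w = 0}. z w) * (\<Prod>w\<in>{w \<in> ?I. s w = 1}. z w)"
      by (rule prod.union_disjoint) (use fin in auto)
    finally show ?thesis .
  qed
  have O: "(\<Prod>x\<in>?O. z x) = (\<Prod>w\<in>{w \<in> ?I. s w = 1}. z w) * (\<Prod>x\<in>{x \<in> tree_W k n. s x = 1}. z x)"
  proof -
    have "?O = {w \<in> ?I. s w = 1} \<union> {x \<in> tree_W k n. s x = 1}"
      by (auto simp: tree_W_def mem_tree_Vn)
    then have "(\<Prod>x\<in>?O. z x) = (\<Prod>x\<in>{w \<in> ?I. s w = 1} \<union> {x \<in> tree_W k n. s x = 1}. z x)"
      by simp
    also have "\<dots> = (\<Prod>w\<in>{w \<in> ?I. s w = 1}. z w) * (\<Prod>x\<in>{x \<in> tree_W k n. s x = 1}. z x)"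
      by (rule prod.union_disjoint) (use fin finite_tree_W in auto)
    finally show ?thesis .
  qed
  have W: "(\<Prod>x\<in>tree_W k n. if s x = 0 then 1 else z x) = (\<Prod>x\<in>{x \<in> tree_W k n. s x = 1}. z x)"
  proof -
    have "tree_W k n \<subseteq> ?V" by (auto simp: tree_W_def mem_tree_Vn)
    then have "(\<Prod>x\<in>tree_W k n. if s x = 0 then 1 else z x) = (\<Prod>x\<in>tree_W k n. if s x = 1 then z x else 1)"
      using s01 by (intro prod.cong) force+
    also have "\<dots> = (\<Prod>x\<in>{x \<in> tree_W k n. s x = 1}. z x)"
      by (rule prod.inter_filter[symmetric, OF finite_tree_W])
    finally show ?thesis .
  qed
  have "(\<Prod>x\<in>?J. (if s x = 1 then lam * z x else 1) / (1 + lam * z x)) =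
    (\<Prod>x\<in>?J. if s x = 1 then lam * z x else 1) * (\<Prod>x\<in>?J. 1 / (1 + lam * z x))"
    by (simp add: prod.distrib[symmetric] divide_inverse)
  then show ?thesis unfolding num den split O hc_weight_def W by simp
qed

text \<open>The law of the coin configuration has cylinder probabilities proportional to the weights, and the constant
  of proportionality is forced because both sides sum to 1.\<close>
lemma hc_gibbs_exists:
  assumes lam: "lam > 0" and z: "hc_equation k lam z"
  shows "\<exists>\<mu>. hc_gibbs k lam z \<mu>"
proof -
  let ?\<mu> = "distr (coins k lam z) (hc_algebra k) (occupation k)"
  let ?\<Omega> = "hc_Omega k (tree_V k)"
  interpret C: prob_space "coins k lam z"
    unfolding coins_def by (intro prob_space_PiM) (rule prob_space_measure_pmf)
  interpret P: prob_space ?\<mu>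
    by (rule C.prob_space_distr) (rule measurable_occupation)
  have "measure ?\<mu> {\<sigma> \<in> ?\<Omega>. restrict \<sigma> (tree_Vn k n) = s} = hc_mu k lam z n s"
    if s: "s \<in> hc_Omega k (tree_Vn k n)" for n s
  proof -
    let ?c = "(\<Prod>x\<in>tree_Vn k n - tree_W k n. z x) / (1 + lam * z [])"
    let ?E = "\<lambda>s. {\<sigma> \<in> ?\<Omega>. restrict \<sigma> (tree_Vn k n) = s}"
    have eq: "measure ?\<mu> (?E t) = ?c * hc_weight k lam z n t"
      if "t \<in> hc_Omega k (tree_Vn k n)" for t
      using that measure_coins_cylinder[OF lam z] cylinder_product_eq_weight[OF lam z] by simp
    have "1 = measure ?\<mu> ?\<Omega>" using P.prob_space by simp
    also have "?\<Omega> = (\<Union>t\<in>hc_Omega k (tree_Vn k n). ?E t)" using restrict_Omega by auto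
    also have "measure ?\<mu> \<dots> = (\<Sum>t\<in>hc_Omega k (tree_Vn k n). measure ?\<mu> (?E t))"
      by (intro P.finite_measure_finite_Union finite_Omega_Vn)
         (auto simp: disjoint_family_on_def intro: sets_cylinder)
    also have "\<dots> = ?c * (\<Sum>t\<in>hc_Omega k (tree_Vn k n). hc_weight k lam z n t)"
      using eq by (simp add: sum_distrib_left)
    finally have "?c = 1 / (\<Sum>t\<in>hc_Omega k (tree_Vn k n). hc_weight k lam z n t)"
      by (metis nonzero_eq_divide_eq mult_zero_right zero_neq_one)
    with eq[OF s] show ?thesis by (simp add: hc_mu_def)
  qed
  then have "hc_gibbs k lam z ?\<mu>"
    unfolding hc_gibbs_def using z P.prob_space_axioms by simp
  then show ?thesis by blast
qed

section \<open>Gibbs measures correspond to their boundary functions\<close>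

text \<open>The boundary function can be read off the measure: the configuration on
  \<^term>\<open>tree_Vn k (length x)\<close> occupied only at \<open>x\<close> and the empty configuration have probabilities in the ratio \<open>\<lambda>z\<^sub>x\<close>.\<close>
lemma hc_gibbs_determines_z:
  assumes lam: "lam > 0" and M: "hc_gibbs k lam z \<mu>" "hc_gibbs k lam z' \<mu>" and x: "x \<in> tree_V k"
  shows "z x = z' x"
proof -
  let ?n = "length x"
  define s0 :: "nat list \<Rightarrow> nat" where "s0 = (\<lambda>y\<in>tree_Vn k ?n. 0)"
  define s1 :: "nat list \<Rightarrow> nat" where "s1 = (\<lambda>y\<in>tree_Vn k ?n. if y = x then 1 else 0)"
  have Om: "s0 \<in> hc_Omega k (tree_Vn k ?n)" "s1 \<in> hc_Omega k (tree_Vn k ?n)"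
    by (auto simp: hc_Omega_Vn_iff s0_def s1_def mem_tree_Vn butlast_in_tree_V)
       (metis diff_less length_butlast length_greater_0_conv less_irrefl zero_less_one)+
  have xV: "x \<in> tree_Vn k ?n" "x \<in> tree_W k ?n" using x by (auto simp: mem_tree_Vn tree_W_def)
  have ratio: "hc_mu k lam w ?n s1 = lam * w x * hc_mu k lam w ?n s0 \<and> hc_mu k lam w ?n s0 > 0"
    if w: "hc_equation k lam w" for w
  proof -
    have W: "y \<in> tree_Vn k ?n" if "y \<in> tree_W k ?n" for y
      using that by (auto simp: mem_tree_Vn tree_W_def)
    have e0: "{y \<in> tree_Vn k ?n. s0 y = 1} = {}" by (auto simp: s0_def)
    have e1: "{y \<in> tree_Vn k ?n. s1 y = 1} = {x}" using xV by (auto simp: s1_def)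
    have w0: "hc_weight k lam w ?n s0 = 1"
      unfolding hc_weight_def e0 using W by (simp add: s0_def)
    have "(\<Prod>y\<in>tree_W k ?n. if s1 y = 0 then 1 else w y) = (\<Prod>y\<in>tree_W k ?n. if y = x then w y else 1)"
      using W by (intro prod.cong) (auto simp: s1_def)
    also have "\<dots> = w x" using xV finite_tree_W by simp
    finally have w1: "hc_weight k lam w ?n s1 = lam * w x"
      unfolding hc_weight_def e1 by simp
    have "hc_weight k lam w ?n t > 0" if "t \<in> hc_Omega k (tree_Vn k ?n)" for t
      unfolding hc_weight_def using lam hc_equation_pos[OF w]
      by (intro mult_pos_pos prod_pos) (auto simp: tree_W_def)
    then have "(\<Sum>t\<in>hc_Omega k (tree_Vn k ?n). hc_weight k lam w ?n t) > 0"
      using Om by (intro sum_pos finite_Omega_Vn) auto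
    then show ?thesis unfolding hc_mu_def w0 w1 by simp
  qed
  have mu: "hc_mu k lam z ?n s = hc_mu k lam z' ?n s" if "s \<in> hc_Omega k (tree_Vn k ?n)" for s
  proof -
    have "hc_mu k lam w ?n s =
      measure \<mu> {\<sigma> \<in> hc_Omega k (tree_V k). restrict \<sigma> (tree_Vn k ?n) = s}"
      if "hc_gibbs k lam w \<mu>" for w
      using that \<open>s \<in> hc_Omega k (tree_Vn k ?n)\<close> unfolding hc_gibbs_def by simp
    from this[OF M(1)] this[OF M(2)] show ?thesis by (rule trans[OF _ sym])
  qed
  have sol: "hc_equation k lam z" "hc_equation k lam z'" using M by (simp_all add: hc_gibbs_def)
  have "lam * z x * hc_mu k lam z ?n s0 = lam * z' x * hc_mu k lam z ?n s0"
    using ratio[OF sol(1)] ratio[OF sol(2)] mu[OF Om(1)] mu[OF Om(2)] by metis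
  moreover have "hc_mu k lam z ?n s0 > 0" using ratio[OF sol(1)] by blast
  ultimately show ?thesis using lam by simp
qed

lemma hc_mu_cong:
  assumes "\<And>x. x \<in> tree_V k \<Longrightarrow> z x = z' x"
  shows "hc_mu k lam z n s = hc_mu k lam z' n s"
proof -
  have "hc_weight k lam z n t = hc_weight k lam z' n t" for t
    unfolding hc_weight_def using assms
    by (intro arg_cong2[where f = "(*)"] prod.cong) (auto simp: tree_W_def)
  then show ?thesis by (simp add: hc_mu_def)
qed

lemma hc_gibbs_cong:
  assumes eq: "\<And>x. x \<in> tree_V k \<Longrightarrow> z x = z' x" and M: "hc_gibbs k lam z \<mu>"
  shows "hc_gibbs k lam z' \<mu>"
proof -
  have "hc_equation k lam z'"
    unfolding hc_equation_def
  proof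
    fix x assume x: "x \<in> tree_V k"
    have "(\<Prod>y\<in>tree_S k x. inverse (1 + lam * z y)) = (\<Prod>y\<in>tree_S k x. inverse (1 + lam * z' y))"
      using x eq by (intro prod.cong) (auto simp: tree_S_iff)
    then show "z' x > 0 \<and> z' x = (\<Prod>y\<in>tree_S k x. inverse (1 + lam * z' y))"
      using M x eq by (auto simp: hc_gibbs_def hc_equation_def)
  qed
  then show ?thesis using M hc_mu_cong[of k z z' lam, OF eq] by (simp add: hc_gibbs_def)
qed

lemma constant_solution_unique:
  fixes lam :: real
  assumes lam: "lam > 0"
  shows "\<exists>!c. c > 0 \<and> c = 1 / (1 + lam * c) ^ k"
proof -
  have eqv: "c = 1 / (1 + lam * c) ^ k \<longleftrightarrow> c * (1 + lam * c) ^ k = 1" if "c > 0" for c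
  proof -
    have "(1 + lam * c) ^ k > 0" using that lam by (simp add: add_pos_pos)
    then have "(1 + lam * c) ^ k \<noteq> 0" by linarith
    from nonzero_eq_divide_eq[OF this] show ?thesis .
  qed
  have "\<exists>c\<ge>0. c \<le> 1 \<and> c * (1 + lam * c) ^ k = 1"
    using lam by (intro IVT') (auto intro!: continuous_intros one_le_power)
  then obtain c where c: "c \<ge> 0" "c * (1 + lam * c) ^ k = 1" by blast
  then have "c > 0" by (cases "c = 0") auto
  moreover have "a = b" if "a > 0" "b > 0" "a * (1 + lam * a) ^ k = 1" "b * (1 + lam * b) ^ k = 1" for a b
  proof -
    have less: "x * (1 + lam * x) ^ k < y * (1 + lam * y) ^ k" if "0 < x" "x < y" for x y
      using that lam by (intro mult_less_le_imp_less power_mono zero_less_power) (auto intro: add_pos_pos)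
    show ?thesis using less[of a b] less[of b a] that by (cases a b rule: linorder_cases) auto
  qed
  ultimately show ?thesis using c eqv by metis
qed

lemma constant_hc_equation:
  "hc_equation k lam (\<lambda>_. c) \<longleftrightarrow> c > 0 \<and> c = 1 / (1 + lam * c) ^ k"
proof -
  have "(\<Prod>y\<in>tree_S k x. inverse (1 + lam * c)) = 1 / (1 + lam * c) ^ k" for x
    by (simp add: card_tree_S power_inverse inverse_eq_divide power_divide)
  then show ?thesis unfolding hc_equation_def using Nil_in_tree_V by metis
qed

lemma hc_TIGMs_singleton:
  assumes lam: "lam > 0" and c: "c > 0" "c = 1 / (1 + lam * c) ^ k"
    and \<mu>: "hc_gibbs k lam (\<lambda>_. c) \<mu>"
  shows "hc_TIGMs k lam = {\<mu>}"
proof (rule set_eqI)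
  fix \<nu>
  have "\<nu> = \<mu>" if \<nu>: "hc_gibbs k lam z \<nu>" and z: "\<forall>x\<in>tree_V k. \<forall>y\<in>tree_V k. z x = z y" for z
  proof -
    have *: "hc_gibbs k lam (\<lambda>_. z []) \<nu>"
      by (rule hc_gibbs_cong[OF _ \<nu>]) (use z Nil_in_tree_V in blast)
    then have "hc_equation k lam (\<lambda>_. z [])" by (simp add: hc_gibbs_def)
    then have "z [] = c"
      using constant_solution_unique[OF lam, of k] c unfolding constant_hc_equation by blast
    with * \<mu> show ?thesis using hc_gibbs_unique by blast
  qed
  then show "\<nu> \<in> hc_TIGMs k lam \<longleftrightarrow> \<nu> \<in> {\<mu>}"
    using \<mu> unfolding hc_TIGMs_def by auto
qed

section \<open>Alternative Gibbs measures correspond to solutions of the system\<close>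
lemma hl_hc_equation:
  assumes a: "hl_arrangement k m r a" and sys: "hl_system k lam m r h l"
  shows "hc_equation k lam (\<lambda>x. if a x then h else l)"
  unfolding hc_equation_def
proof
  let ?z = "\<lambda>x. if a x then h else l"
  fix x assume x: "x \<in> tree_V k"
  let ?H = "{y \<in> tree_S k x. a y}" and ?L = "{y \<in> tree_S k x. \<not> a y}"
  have "(\<Prod>y\<in>tree_S k x. inverse (1 + lam * ?z y)) =
    (\<Prod>y\<in>?H. inverse (1 + lam * ?z y)) * (\<Prod>y\<in>?L. inverse (1 + lam * ?z y))"
    by (subst prod.union_disjoint[symmetric]) (auto intro!: prod.cong)
  also have "\<dots> = 1 / ((1 + lam * h) ^ card ?H * (1 + lam * l) ^ card ?L)"
    by (simp add: power_inverse divide_inverse)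
  finally show "?z x > 0 \<and> ?z x = (\<Prod>y\<in>tree_S k x. inverse (1 + lam * ?z y))"
    using a sys x unfolding hl_arrangement_def hl_system_def by (auto simp: mult.commute)
qed

text \<open>If both symbols occur, then the function \<open>z\<close> determines \<open>h\<close> and \<open>l\<close>, and it is constant only for \<open>h = l\<close>.\<close>
lemma hl_arrangement_both_symbols:
  assumes a: "hl_arrangement k m r a" and mr: "m < k" "r < k"
  shows "\<exists>x\<in>tree_V k. a x" "\<exists>x\<in>tree_V k. \<not> a x"
proof -
  have child: "y \<in> tree_V k" if "y \<in> tree_S k []" for y using that by (simp add: tree_S_iff)
  have "{y \<in> tree_S k []. \<not> a y} \<noteq> {}" if "a []"
  proof -
    have "card {y \<in> tree_S k []. \<not> a y} = k - m"
      using a that Nil_in_tree_V unfolding hl_arrangement_def by blast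
    then show ?thesis using mr by force
  qed
  moreover have "{y \<in> tree_S k []. a y} \<noteq> {}" if "\<not> a []"
  proof -
    have "card {y \<in> tree_S k []. a y} = k - r"
      using a that Nil_in_tree_V unfolding hl_arrangement_def by blast
    then show ?thesis using mr by force
  qed
  ultimately show "\<exists>x\<in>tree_V k. a x" "\<exists>x\<in>tree_V k. \<not> a x"
    using child Nil_in_tree_V by blast+
qed

definition asym_solutions :: "nat \<Rightarrow> real \<Rightarrow> nat \<Rightarrow> nat \<Rightarrow> (real \<times> real) set" where
  "asym_solutions k lam m r = {(h, l). hl_system k lam m r h l \<and> h \<noteq> l}"

text \<open>Solutions of the system, functions \<open>z\<close> and measures are in bijection. On the diagonal \<open>h = l\<close> the system has
  exactly one solution, and it produces the translation-invariant measure; what remains is to count the solutions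
  off the diagonal.\<close>
lemma AGM_classification:
  assumes lam: "lam > 0" and mr: "m < k" "r < k" and a: "hl_arrangement k m r a"
  obtains \<mu>0 \<Phi> where "hc_TIGMs k lam = {\<mu>0}"
    "hc_AGMs k lam m r a = insert \<mu>0 (\<Phi> ` asym_solutions k lam m r)"
    "inj_on \<Phi> (asym_solutions k lam m r)"
    "\<mu>0 \<notin> \<Phi> ` asym_solutions k lam m r"
proof -
  define z where "z = (\<lambda>(h, l) x. if a x then h else (l::real))"
  define \<Phi> where "\<Phi> p = (SOME \<mu>. hc_gibbs k lam (z p) \<mu>)" for p
  define Sol where "Sol = {(h, l). hl_system k lam m r h l}"
  have \<Phi>: "hc_gibbs k lam (z p) (\<Phi> p)" if "p \<in> Sol" for p
    unfolding \<Phi>_def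
    by (rule someI_ex, rule hc_gibbs_exists[OF lam]) (use that hl_hc_equation[OF a] in \<open>auto simp: z_def Sol_def\<close>)
  have AGMs: "hc_AGMs k lam m r a = \<Phi> ` Sol"
  proof (intro equalityI subsetI)
    fix \<mu> assume "\<mu> \<in> hc_AGMs k lam m r a"
    then obtain h l where p: "(h, l) \<in> Sol" and "hc_gibbs k lam (z (h, l)) \<mu>"
      by (auto simp: hc_AGMs_def Sol_def z_def)
    then have "\<mu> = \<Phi> (h, l)" using \<Phi> hc_gibbs_unique by blast
    with p show "\<mu> \<in> \<Phi> ` Sol" by blast
  next
    fix \<mu> assume "\<mu> \<in> \<Phi> ` Sol"
    then show "\<mu> \<in> hc_AGMs k lam m r a" using \<Phi>
      by (fastforce simp: hc_AGMs_def Sol_def z_def)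
  qed
  have inj: "inj_on \<Phi> Sol"
  proof (rule inj_onI)
    fix p q assume pq: "p \<in> Sol" "q \<in> Sol" "\<Phi> p = \<Phi> q"
    have eq: "z p x = z q x" if "x \<in> tree_V k" for x
      using hc_gibbs_determines_z[OF lam \<Phi>[OF pq(1)] _ that] \<Phi>[OF pq(2)] pq(3) by simp
    show "p = q"
      using hl_arrangement_both_symbols[OF a mr] eq
      by (cases p; cases q) (fastforce simp: z_def)
  qed
  obtain c where c: "c > 0" "c = 1 / (1 + lam * c) ^ k"
    and cu: "\<And>d. d > 0 \<Longrightarrow> d = 1 / (1 + lam * d) ^ k \<Longrightarrow> d = c"
    using constant_solution_unique[OF lam, of k] by blast
  have diag: "hl_system k lam m r h h \<longleftrightarrow> h > 0 \<and> h = 1 / (1 + lam * h) ^ k" for h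
  proof -
    have pow: "(1 + lam * h) ^ i * (1 + lam * h) ^ (k - i) = (1 + lam * h) ^ k" if "i < k" for i
      using that by (simp add: power_add[symmetric])
    show ?thesis unfolding hl_system_def pow[OF mr(1)] pow[OF mr(2)] by blast
  qed
  then have "hl_system k lam m r h h \<longleftrightarrow> h = c" for h using c cu by blast
  then have Sol: "Sol = insert (c, c) (asym_solutions k lam m r)"
    by (auto simp: Sol_def asym_solutions_def)
  have "z (c, c) = (\<lambda>_. c)" by (auto simp: z_def)
  then have "hc_TIGMs k lam = {\<Phi> (c, c)}"
    using \<Phi>[of "(c, c)"] Sol by (intro hc_TIGMs_singleton[OF lam c]) simp
  moreover have "(c, c) \<notin> asym_solutions k lam m r" by (simp add: asym_solutions_def)
  moreover from this have "\<Phi> (c, c) \<notin> \<Phi> ` asym_solutions k lam m r"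
    using inj unfolding Sol by simp
  ultimately show thesis
    using that[of "\<Phi> (c, c)" \<Phi>] inj AGMs unfolding Sol by simp
qed

section \<open>Counting along a unimodal branch of solutions\<close>
lemma level_sets_of_unimodal:
  fixes g g' :: "real \<Rightarrow> real"
  assumes t0: "t0 > 0"
    and der: "\<And>t. t > 0 \<Longrightarrow> (g has_real_derivative g' t) (at t)"
    and neg: "\<And>t. 0 < t \<Longrightarrow> t < t0 \<Longrightarrow> g' t < 0"
    and pos: "\<And>t. t0 < t \<Longrightarrow> g' t > 0"
    and lim0: "filterlim g at_top (at_right 0)"
    and lim1: "filterlim g at_top at_top"
  shows "c < g t0 \<Longrightarrow> {t. 0 < t \<and> g t = c} = {}"
    and "{t. 0 < t \<and> g t = g t0} = {t0}"
    and "g t0 < c \<Longrightarrow> \<exists>t1 t2. 0 < t1 \<and> t1 < t0 \<and> t0 < t2 \<and> {t. 0 < t \<and> g t = c} = {t1, t2}"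
proof -
  have cont: "continuous_on {s..t} g" if "0 < s" for s t
    using that by (intro continuous_at_imp_continuous_on ballI DERIV_isCont[OF der]) simp
  have dec: "g t < g s" if "0 < s" "s < t" "t \<le> t0" for s t
  proof (rule DERIV_neg_imp_decreasing_open[OF that(2)])
    show "\<exists>y. DERIV g x :> y \<and> y < 0" if "s < x" "x < t" for x
      using der[of x] neg[of x] that \<open>0 < s\<close> \<open>t \<le> t0\<close> by (intro exI[of _ "g' x"]) simp
    show "continuous_on {s..t} g" by (rule cont[OF that(1)])
  qed
  have inc: "g s < g t" if "t0 \<le> s" "s < t" for s t
  proof (rule DERIV_pos_imp_increasing_open[OF that(2)])
    show "\<exists>y. DERIV g x :> y \<and> 0 < y" if "s < x" "x < t" for x
      using der[of x] pos[of x] that t0 \<open>t0 \<le> s\<close> by (intro exI[of _ "g' x"]) simp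
    show "continuous_on {s..t} g" using cont that t0 by simp
  qed
  have min: "g t0 < g t" if "0 < t" "t \<noteq> t0" for t
    using that dec[of t t0] inc[of t0 t] by (cases "t < t0") auto
  show "{t. 0 < t \<and> g t = c} = {}" if "c < g t0"
    using that min by force
  show "{t. 0 < t \<and> g t = g t0} = {t0}"
    using min t0 by force
  show "\<exists>t1 t2. 0 < t1 \<and> t1 < t0 \<and> t0 < t2 \<and> {t. 0 < t \<and> g t = c} = {t1, t2}" if c: "g t0 < c"
  proof -
    have "eventually (\<lambda>t. c \<le> g t \<and> 0 < t \<and> t < t0) (at_right 0)"
      using lim0 t0 eventually_at_right_less[of "0::real"] eventually_at_right_field
      unfolding filterlim_at_top by (auto intro!: eventually_conj)
    then obtain a where a: "c \<le> g a" "0 < a" "a < t0"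
      using eventually_happens'[OF trivial_limit_at_right_real] by blast
    have "eventually (\<lambda>t. c \<le> g t \<and> t0 < t) at_top"
      using lim1 eventually_gt_at_top unfolding filterlim_at_top by (auto intro: eventually_conj)
    then obtain b where b: "c \<le> g b" "t0 < b"
      using eventually_happens'[OF trivial_limit_at_top_linorder] by blast
    obtain t1 where t1: "a \<le> t1" "t1 \<le> t0" "g t1 = c"
      using IVT2'[of g t0 c a] a c cont[of a t0] by auto
    obtain t2 where t2: "t0 \<le> t2" "t2 \<le> b" "g t2 = c"
      using IVT'[of g t0 c b] b c cont[of t0 b] t0 by auto
    have "t1 \<noteq> t0" "t2 \<noteq> t0" using t1 t2 c by auto
    moreover have "t = t1 \<or> t = t2" if "0 < t" "g t = c" for t
    proof (cases "t \<le> t0")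
      case True
      then show ?thesis
        using dec[of t t1] dec[of t1 t] that t1 a by (cases t t1 rule: linorder_cases) auto
    next
      case False
      then show ?thesis
        using inc[of t t2] inc[of t2 t] that t2 by (cases t t2 rule: linorder_cases) auto
    qed
    ultimately show ?thesis
      using t1 t2 a t0 by (intro exI[of _ t1] exI[of _ t2]) auto
  qed
qed

lemma AGM_count:
  assumes lam: "lam > 0" and mr: "m < k" "r < k" and a: "hl_arrangement k m r a"
  shows "asym_solutions k lam m r = {} \<Longrightarrow>
      \<exists>\<mu>0. hc_TIGMs k lam = {\<mu>0} \<and> hc_AGMs k lam m r a = {\<mu>0}"
    and "asym_solutions k lam m r = {p} \<Longrightarrow>
      \<exists>\<mu>0 \<mu>'. hc_TIGMs k lam = {\<mu>0} \<and> hc_AGMs k lam m r a = {\<mu>0, \<mu>'} \<and> \<mu>' \<notin> hc_TIGMs k lam"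
    and "asym_solutions k lam m r = {p, q} \<Longrightarrow> p \<noteq> q \<Longrightarrow>
      \<exists>\<mu>0 \<mu>1 \<mu>2. hc_TIGMs k lam = {\<mu>0} \<and> hc_AGMs k lam m r a = {\<mu>0, \<mu>1, \<mu>2} \<and>
        \<mu>1 \<noteq> \<mu>2 \<and> \<mu>1 \<notin> hc_TIGMs k lam \<and> \<mu>2 \<notin> hc_TIGMs k lam"
proof -
  obtain \<mu>0 \<Phi> where T: "hc_TIGMs k lam = {\<mu>0}"
    and A: "hc_AGMs k lam m r a = insert \<mu>0 (\<Phi> ` asym_solutions k lam m r)"
    and inj: "inj_on \<Phi> (asym_solutions k lam m r)"
    and new: "\<mu>0 \<notin> \<Phi> ` asym_solutions k lam m r"
    by (rule AGM_classification[OF lam mr a])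
  show "\<exists>\<mu>0. hc_TIGMs k lam = {\<mu>0} \<and> hc_AGMs k lam m r a = {\<mu>0}"
    if "asym_solutions k lam m r = {}"
    using T A that by simp
  show "\<exists>\<mu>0 \<mu>'. hc_TIGMs k lam = {\<mu>0} \<and> hc_AGMs k lam m r a = {\<mu>0, \<mu>'} \<and> \<mu>' \<notin> hc_TIGMs k lam"
    if "asym_solutions k lam m r = {p}"
  proof (intro exI conjI)
    show "hc_TIGMs k lam = {\<mu>0}" by (rule T)
    show "hc_AGMs k lam m r a = {\<mu>0, \<Phi> p}" unfolding A that by simp
    show "\<Phi> p \<notin> hc_TIGMs k lam" using new unfolding T that by simp
  qed
  show "\<exists>\<mu>0 \<mu>1 \<mu>2. hc_TIGMs k lam = {\<mu>0} \<and> hc_AGMs k lam m r a = {\<mu>0, \<mu>1, \<mu>2} \<and>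
        \<mu>1 \<noteq> \<mu>2 \<and> \<mu>1 \<notin> hc_TIGMs k lam \<and> \<mu>2 \<notin> hc_TIGMs k lam"
    if "asym_solutions k lam m r = {p, q}" "p \<noteq> q"
  proof (intro exI conjI)
    show "hc_TIGMs k lam = {\<mu>0}" by (rule T)
    show "hc_AGMs k lam m r a = {\<mu>0, \<Phi> p, \<Phi> q}" unfolding A that(1) by simp
    show "\<Phi> p \<noteq> \<Phi> q" using inj that(2) unfolding that(1) by simp
    show "\<Phi> p \<notin> hc_TIGMs k lam" "\<Phi> q \<notin> hc_TIGMs k lam"
      using new unfolding T that(1) by auto
  qed
qed

text \<open>At \<open>lam_merge\<close> one of the two solutions off the diagonal has moved onto the diagonal, which leaves the same
  picture as at \<open>lam_cr\<close>.\<close>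
definition AGM_transition ::
  "nat \<Rightarrow> nat \<Rightarrow> nat \<Rightarrow> (nat list \<Rightarrow> bool) \<Rightarrow> real \<Rightarrow> real \<Rightarrow> bool" where
  "AGM_transition k m r a lam_cr lam_merge \<longleftrightarrow>
    (\<forall>lam. 0 < lam \<and> lam < lam_cr \<longrightarrow>
      (\<exists>\<mu>0. hc_TIGMs k lam = {\<mu>0} \<and> hc_AGMs k lam m r a = {\<mu>0})) \<and>
    (\<forall>lam. lam = lam_cr \<or> lam = lam_merge \<longrightarrow>
      (\<exists>\<mu>0 \<mu>'. hc_TIGMs k lam = {\<mu>0} \<and> hc_AGMs k lam m r a = {\<mu>0, \<mu>'} \<and>
        \<mu>' \<notin> hc_TIGMs k lam)) \<and>
    (\<forall>lam. lam > lam_cr \<and> lam \<noteq> lam_merge \<longrightarrow>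
      (\<exists>\<mu>0 \<mu>1 \<mu>2. hc_TIGMs k lam = {\<mu>0} \<and> hc_AGMs k lam m r a = {\<mu>0, \<mu>1, \<mu>2} \<and>
        \<mu>1 \<noteq> \<mu>2 \<and> \<mu>1 \<notin> hc_TIGMs k lam \<and> \<mu>2 \<notin> hc_TIGMs k lam))"

text \<open>If the solutions with \<open>h \<noteq> l\<close> form a curve with parameter \<open>t\<close> along which \<open>\<lambda> = g t\<close>, punctured at its
  intersection \<open>t = 1\<close> with the diagonal, then the number of solutions is the number of points other than 1 in a
  level set of \<open>g\<close>. For unimodal \<open>g\<close> a level set has 0, 1 or 2 points, according to the position of the level relative
  to the minimum at \<open>t0\<close>; the level \<open>g 1\<close> loses the point 1.\<close>
lemma AGM_transition_of_unimodal:
  fixes g g' :: "real \<Rightarrow> real"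
  assumes mr: "m < k" "r < k" and a: "hl_arrangement k m r a"
    and par: "\<And>lam. lam > 0 \<Longrightarrow>
      asym_solutions k lam m r = \<psi> lam ` {t. 0 < t \<and> t \<noteq> 1 \<and> g t = lam}"
    and inj: "\<And>lam. lam > 0 \<Longrightarrow> inj_on (\<psi> lam) {t. 0 < t \<and> t \<noteq> 1 \<and> g t = lam}"
    and gpos: "\<And>t. t > 0 \<Longrightarrow> g t > 0"
    and t0: "t0 > 0" "t0 \<noteq> 1"
    and der: "\<And>t. t > 0 \<Longrightarrow> (g has_real_derivative g' t) (at t)"
    and neg: "\<And>t. 0 < t \<Longrightarrow> t < t0 \<Longrightarrow> g' t < 0"
    and pos: "\<And>t. t0 < t \<Longrightarrow> g' t > 0"
    and lim: "filterlim g at_top (at_right 0)" "filterlim g at_top at_top"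
  shows "AGM_transition k m r a (g t0) (g 1)"
proof -
  have level1: "{t. 0 < t \<and> g t = c} = {}" if "c < g t0" for c
    using level_sets_of_unimodal(1)[of t0 g g' c] t0 der neg pos lim that by blast
  have level2: "{t. 0 < t \<and> g t = g t0} = {t0}"
    using level_sets_of_unimodal(2)[of t0 g g'] t0 der neg pos lim by blast
  have level3: "\<exists>t1 t2. 0 < t1 \<and> t1 < t0 \<and> t0 < t2 \<and> {t. 0 < t \<and> g t = c} = {t1, t2}"
    if "g t0 < c" for c
    using level_sets_of_unimodal(3)[of t0 g g' c] t0 der neg pos lim that by blast
  have drop1: "{t. 0 < t \<and> t \<noteq> 1 \<and> g t = lam} = {t. 0 < t \<and> g t = lam} - {1}" for lam by auto
  have "g t0 \<noteq> g 1"
  proof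
    assume "g t0 = g 1"
    then have "1 \<in> {t. 0 < t \<and> g t = g t0}" by simp
    then have "1 \<in> {t0}" by (simp only: level2)
    with t0 show False by simp
  qed
  moreover have "\<not> g 1 < g t0"
  proof
    assume "g 1 < g t0"
    from level1[OF this] have "1 \<notin> {t. 0 < t \<and> g t = g 1}" by blast
    then show False by simp
  qed
  ultimately have above: "g t0 < g 1" by simp
  note count = AGM_count[OF _ mr a]
  have unique: "\<exists>\<mu>0. hc_TIGMs k lam = {\<mu>0} \<and> hc_AGMs k lam m r a = {\<mu>0}"
    if "0 < lam" "lam < g t0" for lam
  proof (rule count(1)[OF that(1)])
    show "asym_solutions k lam m r = {}" unfolding par[OF that(1)] drop1 level1[OF that(2)] by simp
  qed
  have two: "\<exists>\<mu>0 \<mu>'. hc_TIGMs k lam = {\<mu>0} \<and> hc_AGMs k lam m r a = {\<mu>0, \<mu>'} \<and> \<mu>' \<notin> hc_TIGMs k lam"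
    if lam: "lam = g t0 \<or> lam = g 1" for lam
  proof -
    have pos: "lam > 0" using lam gpos[OF t0(1)] gpos[of 1] by (elim disjE) simp_all
    have "\<exists>t. {t. 0 < t \<and> t \<noteq> 1 \<and> g t = lam} = {t}"
    proof (cases "lam = g t0")
      case True
      have "{t. 0 < t \<and> g t = lam} - {1} = {t0}" unfolding True level2 using t0 by simp
      then show ?thesis unfolding drop1 by blast
    next
      case False
      then have l1: "lam = g 1" using lam by simp
      obtain t1 t2 where t: "t1 < t0" "t0 < t2" and eq: "{t. 0 < t \<and> g t = lam} = {t1, t2}"
        using level3[OF above] l1 by blast
      have "1 \<in> {t. 0 < t \<and> g t = lam}" using l1 by simp
      then have "1 = t1 \<or> 1 = t2" unfolding eq by simp
      then have "{t1, t2} - {1} = {t2} \<or> {t1, t2} - {1} = {t1}" using t by (elim disjE) auto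
      then show ?thesis unfolding drop1 eq by blast
    qed
    then obtain t where "{t. 0 < t \<and> t \<noteq> 1 \<and> g t = lam} = {t}" by blast
    then have "asym_solutions k lam m r = {\<psi> lam t}" unfolding par[OF pos] by simp
    then show ?thesis by (rule count(2)[OF pos])
  qed
  have three: "\<exists>\<mu>0 \<mu>1 \<mu>2. hc_TIGMs k lam = {\<mu>0} \<and> hc_AGMs k lam m r a = {\<mu>0, \<mu>1, \<mu>2} \<and>
        \<mu>1 \<noteq> \<mu>2 \<and> \<mu>1 \<notin> hc_TIGMs k lam \<and> \<mu>2 \<notin> hc_TIGMs k lam"
    if lam: "lam > g t0" "lam \<noteq> g 1" for lam
  proof -
    have pos: "lam > 0" using lam gpos[OF t0(1)] by simp
    obtain t1 t2 where t: "t1 < t0" "t0 < t2" and eq: "{t. 0 < t \<and> g t = lam} = {t1, t2}"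
      using level3[OF lam(1)] by blast
    have "1 \<notin> {t. 0 < t \<and> g t = lam}" using lam by simp
    then have T: "{t. 0 < t \<and> t \<noteq> 1 \<and> g t = lam} = {t1, t2}" unfolding drop1 eq by auto
    have "\<psi> lam t1 \<noteq> \<psi> lam t2"
      using inj[OF pos] t unfolding T by auto
    moreover have "asym_solutions k lam m r = {\<psi> lam t1, \<psi> lam t2}"
      unfolding par[OF pos] T by simp
    ultimately show ?thesis by (intro count(3)[OF pos])
  qed
  show ?thesis unfolding AGM_transition_def
    by (intro conjI allI impI unique two three) simp_all
qed

text \<open>Exchanging the roles of the two symbols exchanges \<open>m\<close> and \<open>r\<close>.\<close>
lemma asym_solutions_swap: "asym_solutions k lam r m = prod.swap ` asym_solutions k lam m r"
  by (force simp: asym_solutions_def hl_system_def image_iff)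

lemma hl_system_iff:
  assumes lam: "lam > 0"
  shows "hl_system k lam m r h l \<longleftrightarrow> h > 0 \<and> l > 0 \<and>
    lam * h * ((1 + lam * h) ^ m * (1 + lam * l) ^ (k - m)) = lam \<and>
    lam * l * ((1 + lam * l) ^ r * (1 + lam * h) ^ (k - r)) = lam"
proof -
  have "x = 1 / P \<longleftrightarrow> lam * x * P = lam" if "P > 0" for x P :: real
    using that lam by (auto simp: field_simps)
  moreover have "(1 + lam * x) ^ i * (1 + lam * y) ^ j > 0" if "x > 0" "y > 0" for x y i j
    using that lam by (intro mult_pos_pos zero_less_power add_pos_pos) auto
  ultimately show ?thesis unfolding hl_system_def by blast
qed

section \<open>The branches of solutions off the diagonal\<close>

text \<open>The activity \<open>\<lambda>\<close> along the branch for \<open>m = 1\<close>, \<open>r = 0\<close>, where \<open>t = (1 + \<lambda>h) / (1 + \<lambda>l)\<close>.\<close>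
definition lam_10 :: "real \<Rightarrow> real" where
  "lam_10 t = (1 + t + t\<^sup>2) ^ 4 / (t * (1 + t) ^ 5)"

text \<open>With \<open>X = 1 + \<lambda>h\<close> and \<open>Y = 1 + \<lambda>l\<close> the system reads \<open>(X - 1) X Y\<^sup>3 = \<lambda> = (Y - 1) X\<^sup>4\<close>. Eliminating \<open>\<lambda>\<close> and
  substituting \<open>X = t Y\<close> leaves \<open>t Y - 1 = (Y - 1) t\<^sup>3\<close>, which is linear in \<open>Y\<close>. After division by \<open>1 - t\<close>, the factor
  that belongs to the diagonal, it gives \<open>Y\<close>, and with it \<open>\<lambda>\<close>, as rational functions of \<open>t\<close>.\<close>
lemma asym_solutions_1_0:
  assumes lam: "lam > 0"
  shows "asym_solutions 4 lam 1 0 =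
    (\<lambda>t. (t\<^sup>2 / (1 + t) / lam, 1 / (t * (1 + t)) / lam)) ` {t. 0 < t \<and> t \<noteq> 1 \<and> lam_10 t = lam}"
    (is "_ = ?\<psi> ` ?T")
proof (intro equalityI subsetI)
  fix p assume "p \<in> asym_solutions 4 lam 1 0"
  then obtain h l where p: "p = (h, l)" and "h \<noteq> l" and sys: "hl_system 4 lam 1 0 h l"
    by (auto simp: asym_solutions_def)
  define X Y t where "X = 1 + lam * h" and "Y = 1 + lam * l" and "t = X / Y"
  have "h > 0" "l > 0" and e1: "(X - 1) * (X * Y ^ 3) = lam" and e2: "(Y - 1) * X ^ 4 = lam"
    using sys unfolding hl_system_iff[OF lam] by (auto simp: X_def Y_def)
  then have X: "X > 1" and Y: "Y > 1" using lam by (auto simp: X_def Y_def)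
  have t: "t > 0" "X = t * Y" using X Y by (auto simp: t_def)
  have "X \<noteq> Y" using \<open>h \<noteq> l\<close> lam by (simp add: X_def Y_def)
  then have "t \<noteq> 1" using t by auto
  have "X * Y ^ 3 * (t * Y - 1) = X * Y ^ 3 * ((Y - 1) * t ^ 3)"
  proof -
    have "X * Y ^ 3 * (t * Y - 1) = (Y - 1) * X ^ 4"
      using e1 e2 by (simp add: t(2) mult.commute)
    also have "\<dots> = X * Y ^ 3 * ((Y - 1) * t ^ 3)" unfolding t(2) by algebra
    finally show ?thesis .
  qed
  then have "t * Y - 1 = (Y - 1) * t ^ 3" using X Y by simp
  then have "(1 - t) * (Y * (t * (1 + t))) = (1 - t) * (1 + t + t\<^sup>2)" by algebra
  then have Y': "Y = (1 + t + t\<^sup>2) / (t * (1 + t))"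
  proof -
    from \<open>(1 - t) * _ = _\<close> have "Y * (t * (1 + t)) = 1 + t + t\<^sup>2" using \<open>t \<noteq> 1\<close> by simp
    then show ?thesis using t by (simp add: eq_divide_eq)
  qed
  have u: "lam * h = t\<^sup>2 / (1 + t)"
  proof -
    have "lam * h = t * Y - 1" using t by (simp add: X_def)
    also have "t * Y = (1 + t + t\<^sup>2) / (1 + t)" unfolding Y' using t by simp
    finally show ?thesis using t by (simp add: field_simps)
  qed
  have v: "lam * l = 1 / (t * (1 + t))"
  proof -
    have "lam * l = Y - 1" by (simp add: Y_def)
    also have "\<dots> = 1 / (t * (1 + t))" unfolding Y' using t
      by (simp add: field_simps power2_eq_square add_nonneg_eq_0_iff)
    finally show ?thesis .
  qed
  have "lam_10 t = lam"
  proof -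
    have "X = (1 + t + t\<^sup>2) / (1 + t)" using t unfolding t(2) Y' by simp
    moreover have "Y - 1 = 1 / (t * (1 + t))" using v by (simp add: Y_def)
    ultimately have "lam = 1 / (t * (1 + t)) * ((1 + t + t\<^sup>2) / (1 + t)) ^ 4" using e2 by simp
    also have "\<dots> = lam_10 t" by (simp add: lam_10_def power_divide eval_nat_numeral)
    finally show ?thesis by simp
  qed
  moreover have "p = ?\<psi> t" unfolding p u[symmetric] v[symmetric] using lam by simp
  ultimately show "p \<in> ?\<psi> ` ?T" using t \<open>t \<noteq> 1\<close> by blast
next
  fix p assume "p \<in> ?\<psi> ` ?T"
  then obtain t where t: "0 < t" "t \<noteq> 1" "lam_10 t = lam" and p: "p = ?\<psi> t" by blast
  define h l where "h = t\<^sup>2 / (1 + t) / lam" and "l = 1 / (t * (1 + t)) / lam"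
  have S: "1 + t + t\<^sup>2 > 0" using t by (simp add: add_pos_pos)
  have u: "lam * h = t\<^sup>2 / (1 + t)" and v: "lam * l = 1 / (t * (1 + t))"
    using lam by (simp_all add: h_def l_def)
  have X: "1 + lam * h = (1 + t + t\<^sup>2) / (1 + t)" and Y: "1 + lam * l = (1 + t + t\<^sup>2) / (t * (1 + t))"
    unfolding u v using t by (simp_all add: field_simps power2_eq_square add_nonneg_eq_0_iff)
  have "h > 0" "l > 0" using t lam by (simp_all add: h_def l_def)
  moreover have "lam * h * ((1 + lam * h) ^ 1 * (1 + lam * l) ^ (4 - 1)) = lam"
  proof -
    have "t\<^sup>2 / (1 + t) * ((1 + t + t\<^sup>2) / (1 + t) * ((1 + t + t\<^sup>2) / (t * (1 + t))) ^ 3) = lam_10 t"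
      using t(1) by (simp add: lam_10_def power_divide eval_nat_numeral mult_ac)
    then show ?thesis unfolding X Y unfolding u using t(3) by simp
  qed
  moreover have "lam * l * ((1 + lam * l) ^ 0 * (1 + lam * h) ^ (4 - 0)) = lam"
  proof -
    have "1 / (t * (1 + t)) * ((1 + t + t\<^sup>2) / (1 + t)) ^ 4 = lam_10 t"
      by (simp add: lam_10_def power_divide eval_nat_numeral)
    then show ?thesis unfolding X Y unfolding v using t(3) by simp
  qed
  ultimately have "hl_system 4 lam 1 0 h l" unfolding hl_system_iff[OF lam] by blast
  moreover have "h \<noteq> l"
  proof
    assume "h = l"
    then have "t\<^sup>2 / (1 + t) * (t * (1 + t)) = 1 / (t * (1 + t)) * (t * (1 + t))"
      unfolding u[symmetric] v[symmetric] by simp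
    then have "t ^ 3 = 1 ^ 3" using t(1) by (simp add: eval_nat_numeral)
    then show False using t by (simp only: power_eq_iff_eq_base)
  qed
  ultimately show "p \<in> asym_solutions 4 lam 1 0" by (simp add: asym_solutions_def p h_def l_def)
qed

lemma inj_on_param_1_0:
  assumes "lam > 0"
  shows "inj_on (\<lambda>t. (t\<^sup>2 / (1 + t) / lam, 1 / (t * (1 + t)) / lam)) {t::real. 0 < t \<and> t \<noteq> 1 \<and> lam_10 t = lam}"
proof (rule inj_onI)
  fix s t :: real
  assume s: "s \<in> {t. 0 < t \<and> t \<noteq> 1 \<and> lam_10 t = lam}" and t: "t \<in> {t. 0 < t \<and> t \<noteq> 1 \<and> lam_10 t = lam}"
    and eq: "(s\<^sup>2 / (1 + s) / lam, 1 / (s * (1 + s)) / lam) = (t\<^sup>2 / (1 + t) / lam, 1 / (t * (1 + t)) / lam)"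
  then have "s * (1 + s) = t * (1 + t)" using assms by simp
  then have "(s - t) * (1 + s + t) = 0" by algebra
  with s t show "s = t" by auto
qed

text \<open>For \<open>m + r = 2\<close> the elimination of \<open>\<lambda>\<close> from the system gives this equation for \<open>u = \<lambda>h\<close> and \<open>v = \<lambda>l\<close>. It is
  \<open>(u - v) (1 - u v) = 0\<close>, so off the diagonal the solutions lie on the hyperbola \<open>u v = 1\<close>, where \<open>t = u\<close> is a
  parameter.\<close>
lemma hyperbola_of_asym_solution:
  fixes u v :: real
  assumes "u \<noteq> v" "u * (1 + v)\<^sup>2 = v * (1 + u)\<^sup>2"
  shows "u * v = 1"
proof -
  have "(u - v) * (1 - u * v) = 0" using assms(2) by algebra
  then show ?thesis using assms(1) by simp
qed

text \<open>Two facts about a system suffice to identify its branch with the hyperbola: \<open>red\<close>, the elimination of \<open>\<lambda>\<close>, and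
  \<open>sys\<close>, which says at which activity the point \<open>(t, 1/t)\<close> is a solution.\<close>
lemma asym_solutions_hyperbola:
  assumes lam: "lam > 0"
    and red: "\<And>h l. hl_system 4 lam m r h l \<Longrightarrow> lam * h * (1 + lam * l)\<^sup>2 = lam * l * (1 + lam * h)\<^sup>2"
    and sys: "\<And>h l t. t > 0 \<Longrightarrow> lam * h = t \<Longrightarrow> lam * l = 1 / t \<Longrightarrow> hl_system 4 lam m r h l \<longleftrightarrow> g t = lam"
  shows "asym_solutions 4 lam m r = (\<lambda>t. (t / lam, 1 / t / lam)) ` {t. 0 < t \<and> t \<noteq> 1 \<and> g t = lam}"
    (is "_ = ?\<psi> ` ?T")
proof (intro equalityI subsetI)
  fix p assume "p \<in> asym_solutions 4 lam m r"
  then obtain h l where p: "p = (h, l)" and "h \<noteq> l" and hl: "hl_system 4 lam m r h l"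
    by (auto simp: asym_solutions_def)
  then have "h > 0" "l > 0" by (auto simp: hl_system_def)
  define t where "t = lam * h"
  have "t > 0" using \<open>h > 0\<close> lam by (simp add: t_def)
  have ne: "lam * h \<noteq> lam * l" using \<open>h \<noteq> l\<close> lam by simp
  have uv: "lam * h * (lam * l) = 1"
    by (rule hyperbola_of_asym_solution[OF ne red[OF hl]])
  then have v: "lam * l = 1 / t" using \<open>t > 0\<close> unfolding t_def[symmetric] by (simp add: eq_divide_eq mult.commute)
  have "t \<noteq> 1" using ne v by (auto simp: t_def)
  moreover have "g t = lam" using sys[OF \<open>t > 0\<close> _ v] hl by (simp add: t_def)
  moreover have "p = ?\<psi> t" unfolding p v[symmetric] using lam by (simp add: t_def)
  ultimately show "p \<in> ?\<psi> ` ?T" using \<open>t > 0\<close> by blast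
next
  fix p assume "p \<in> ?\<psi> ` ?T"
  then obtain t where t: "0 < t" "t \<noteq> 1" "g t = lam" and p: "p = ?\<psi> t" by blast
  have "hl_system 4 lam m r (t / lam) (1 / t / lam)"
    using t lam by (subst sys[of t]) auto
  moreover have "t / lam \<noteq> 1 / t / lam"
  proof
    assume "t / lam = 1 / t / lam"
    then have "t ^ 2 = 1 ^ 2" using t lam by (simp add: field_simps power2_eq_square)
    then show False using t by (simp only: power_eq_iff_eq_base)
  qed
  ultimately show "p \<in> asym_solutions 4 lam m r" by (simp add: asym_solutions_def p)
qed

text \<open>The activity at the point \<open>(t, 1/t)\<close> of the hyperbola, for \<open>m = r = 1\<close> and for \<open>m = 2\<close>, \<open>r = 0\<close>.\<close>
definition lam_11 :: "real \<Rightarrow> real" where "lam_11 t = (1 + t) ^ 4 / t\<^sup>2"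

definition lam_20 :: "real \<Rightarrow> real" where "lam_20 t = (1 + t) ^ 4 / t"

lemma asym_solutions_1_1:
  assumes lam: "lam > 0"
  shows "asym_solutions 4 lam 1 1 =
    (\<lambda>t. (t / lam, 1 / t / lam)) ` {t. 0 < t \<and> t \<noteq> 1 \<and> lam_11 t = lam}"
proof (rule asym_solutions_hyperbola[OF lam])
  fix h l assume sys: "hl_system 4 lam 1 1 h l"
  then have "lam * h > 0" "lam * l > 0" using lam by (auto simp: hl_system_def)
  then have P: "1 + lam * h \<noteq> 0" "1 + lam * l \<noteq> 0" by linarith+
  have "lam * h * ((1 + lam * h) ^ 1 * (1 + lam * l) ^ (4 - 1)) =
    lam * l * ((1 + lam * l) ^ 1 * (1 + lam * h) ^ (4 - 1))"
    using sys unfolding hl_system_iff[OF lam] by argo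
  then have "(1 + lam * h) * (1 + lam * l) * (lam * h * (1 + lam * l)\<^sup>2) =
    (1 + lam * h) * (1 + lam * l) * (lam * l * (1 + lam * h)\<^sup>2)"
    by (simp add: eval_nat_numeral mult_ac)
  then show "lam * h * (1 + lam * l)\<^sup>2 = lam * l * (1 + lam * h)\<^sup>2" using P by simp
next
  fix h l t :: real assume t: "t > 0" and uv: "lam * h = t" "lam * l = 1 / t"
  have "h > 0" "l > 0" using t uv lam by (metis zero_less_mult_pos zero_less_divide_1_iff)+
  moreover have Y: "1 + 1 / t = (1 + t) / t" using t by (simp add: field_simps)
  have "t * ((1 + t) ^ 1 * (1 + 1 / t) ^ (4 - 1)) = lam_11 t"
    "1 / t * ((1 + 1 / t) ^ 1 * (1 + t) ^ (4 - 1)) = lam_11 t"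
    unfolding Y using t by (simp_all add: lam_11_def power_divide eval_nat_numeral)
  ultimately show "hl_system 4 lam 1 1 h l \<longleftrightarrow> lam_11 t = lam"
    unfolding hl_system_iff[OF lam] uv by simp
qed

lemma asym_solutions_2_0:
  assumes lam: "lam > 0"
  shows "asym_solutions 4 lam 2 0 =
    (\<lambda>t. (t / lam, 1 / t / lam)) ` {t. 0 < t \<and> t \<noteq> 1 \<and> lam_20 t = lam}"
proof (rule asym_solutions_hyperbola[OF lam])
  fix h l assume sys: "hl_system 4 lam 2 0 h l"
  then have "lam * h > 0" using lam by (auto simp: hl_system_def)
  then have P: "1 + lam * h \<noteq> 0" by linarith
  have "lam * h * ((1 + lam * h) ^ 2 * (1 + lam * l) ^ (4 - 2)) =
    lam * l * ((1 + lam * l) ^ 0 * (1 + lam * h) ^ (4 - 0))"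
    using sys unfolding hl_system_iff[OF lam] by argo
  then have "(1 + lam * h)\<^sup>2 * (lam * h * (1 + lam * l)\<^sup>2) =
    (1 + lam * h)\<^sup>2 * (lam * l * (1 + lam * h)\<^sup>2)"
    by (simp add: eval_nat_numeral mult_ac)
  then show "lam * h * (1 + lam * l)\<^sup>2 = lam * l * (1 + lam * h)\<^sup>2" using P by simp
next
  fix h l t :: real assume t: "t > 0" and uv: "lam * h = t" "lam * l = 1 / t"
  have "h > 0" "l > 0" using t uv lam by (metis zero_less_mult_pos zero_less_divide_1_iff)+
  moreover have Y: "1 + 1 / t = (1 + t) / t" using t by (simp add: field_simps)
  have "t * ((1 + t) ^ 2 * (1 + 1 / t) ^ (4 - 2)) = lam_20 t"
    "1 / t * ((1 + 1 / t) ^ 0 * (1 + t) ^ (4 - 0)) = lam_20 t"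
    unfolding Y using t by (simp_all add: lam_20_def power_divide eval_nat_numeral)
  ultimately show "hl_system 4 lam 2 0 h l \<longleftrightarrow> lam_20 t = lam"
    unfolding hl_system_iff[OF lam] uv by simp
qed

lemma inj_on_param_hyperbola:
  "lam > 0 \<Longrightarrow> inj_on (\<lambda>t. (t / lam, 1 / t / lam)) (A :: real set)"
  by (rule inj_onI) simp

section \<open>Minima of the activity along the branches\<close>
lemma lam_10_has_derivative:
  assumes "t > 0"
  shows "(lam_10 has_real_derivative
    (1 + t + t\<^sup>2) ^ 3 * (2 * t ^ 3 + 5 * t\<^sup>2 - 3 * t - 1) / (t\<^sup>2 * (1 + t) ^ 6)) (at t)"
proof -
  have "((\<lambda>t. (1 + t + t\<^sup>2) ^ 4 / (t * (1 + t) ^ 5)) has_real_derivative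
    ((4 * (1 + t + t\<^sup>2) ^ 3 * (1 + 2 * t)) * (t * (1 + t) ^ 5) -
      (1 + t + t\<^sup>2) ^ 4 * ((1 + t) ^ 5 + t * (5 * (1 + t) ^ 4))) / (t * (1 + t) ^ 5)\<^sup>2) (at t)"
    using assms by (auto intro!: derivative_eq_intros simp: power2_eq_square)
  also have "((4 * (1 + t + t\<^sup>2) ^ 3 * (1 + 2 * t)) * (t * (1 + t) ^ 5) -
      (1 + t + t\<^sup>2) ^ 4 * ((1 + t) ^ 5 + t * (5 * (1 + t) ^ 4))) =
    (1 + t) ^ 4 * ((1 + t + t\<^sup>2) ^ 3 * (2 * t ^ 3 + 5 * t\<^sup>2 - 3 * t - 1))" by algebra
  also have "(t * (1 + t) ^ 5)\<^sup>2 = (1 + t) ^ 4 * (t\<^sup>2 * (1 + t) ^ 6)" by algebra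
  also have "(1 + t) ^ 4 * ((1 + t + t\<^sup>2) ^ 3 * (2 * t ^ 3 + 5 * t\<^sup>2 - 3 * t - 1)) /
      ((1 + t) ^ 4 * (t\<^sup>2 * (1 + t) ^ 6)) =
    (1 + t + t\<^sup>2) ^ 3 * (2 * t ^ 3 + 5 * t\<^sup>2 - 3 * t - 1) / (t\<^sup>2 * (1 + t) ^ 6)"
    using assms by (intro mult_divide_mult_cancel_left) simp
  finally show ?thesis by (simp add: lam_10_def[abs_def])
qed

lemma lam_11_has_derivative:
  assumes "t > 0"
  shows "(lam_11 has_real_derivative (1 + t) ^ 3 * (2 * t - 2) / t ^ 3) (at t)"
proof -
  have "((\<lambda>t. (1 + t) ^ 4 / t\<^sup>2) has_real_derivative
    ((4 * (1 + t) ^ 3) * t\<^sup>2 - (1 + t) ^ 4 * (2 * t)) / (t\<^sup>2 * t\<^sup>2)) (at t)"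
    using assms by (auto intro!: derivative_eq_intros)
  also have "(4 * (1 + t) ^ 3) * t\<^sup>2 - (1 + t) ^ 4 * (2 * t) = t * ((1 + t) ^ 3 * (2 * t - 2))"
    by algebra
  also have "t\<^sup>2 * t\<^sup>2 = t * t ^ 3" by algebra
  finally show ?thesis using assms by (simp add: lam_11_def[abs_def])
qed

lemma lam_20_has_derivative:
  assumes "t > 0"
  shows "(lam_20 has_real_derivative (1 + t) ^ 3 * (3 * t - 1) / t\<^sup>2) (at t)"
proof -
  have "((\<lambda>t. (1 + t) ^ 4 / t) has_real_derivative
    ((4 * (1 + t) ^ 3) * t - (1 + t) ^ 4) / (t * t)) (at t)"
    using assms by (auto intro!: derivative_eq_intros)
  also have "(4 * (1 + t) ^ 3) * t - (1 + t) ^ 4 = (1 + t) ^ 3 * (3 * t - 1)" by algebra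
  finally show ?thesis by (simp add: lam_20_def[abs_def] power2_eq_square)
qed

lemma branch_lambda_pos:
  assumes "t > 0" shows "lam_10 t > 0" "lam_11 t > 0" "lam_20 t > 0"
  unfolding lam_10_def lam_11_def lam_20_def
  by (intro divide_pos_pos mult_pos_pos zero_less_power add_pos_pos; use assms in simp)+

lemma branch_lambda_limits:
  "filterlim lam_10 at_top (at_right 0)" "filterlim lam_10 at_top at_top"
  "filterlim lam_11 at_top (at_right 0)" "filterlim lam_11 at_top at_top"
  "filterlim lam_20 at_top (at_right 0)" "filterlim lam_20 at_top at_top"
  unfolding lam_10_def lam_11_def lam_20_def by real_asymp+

text \<open>The cubic changes sign once on the positive axis because its quotient by \<open>t\<close>, namely \<open>2t\<^sup>2 + 5t - 3 - 1/t\<close>, is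
  strictly increasing. The interval for the root is short enough for the estimate of the critical activity to
  two decimals.\<close>
lemma lam_10_critical_point:
  obtains t0 :: real where "0.69475 \<le> t0" "t0 \<le> 0.6948"
    "\<And>t. 0 < t \<Longrightarrow> t < t0 \<Longrightarrow> 2 * t ^ 3 + 5 * t\<^sup>2 - 3 * t - 1 < 0"
    "\<And>t. t0 < t \<Longrightarrow> 2 * t ^ 3 + 5 * t\<^sup>2 - 3 * t - 1 > 0"
proof -
  let ?Q = "\<lambda>t::real. 2 * t ^ 3 + 5 * t\<^sup>2 - 3 * t - 1"
  have "\<exists>t\<ge>0.69475. t \<le> 0.6948 \<and> ?Q t = 0"
    by (intro IVT') (auto intro!: continuous_intros simp: eval_nat_numeral)
  then obtain t0 where t0: "0.69475 \<le> t0" "t0 \<le> 0.6948" "?Q t0 = 0" by blast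
  \<comment> \<open>Monotonicity of \<open>?Q t / t\<close>, cleared of denominators.\<close>
  have less: "?Q s * t < ?Q t * s" if "0 < s" "s < t" for s t
  proof -
    have "?Q t * s - ?Q s * t = (t - s) * (s * t * (2 * (s + t) + 5) + 1)" by algebra
    moreover have "\<dots> > 0" using that by (intro mult_pos_pos) (auto intro: add_pos_pos)
    ultimately show ?thesis by linarith
  qed
  have "?Q t < 0" if "0 < t" "t < t0" for t
    using less[OF that] t0 that by (simp add: mult_less_0_iff)
  moreover have "?Q t > 0" if "t0 < t" for t
    using less[of t0 t] t0 that by (simp add: zero_less_mult_iff)
  ultimately show thesis using that t0 by blast
qed

text \<open>Numerator and denominator are increasing in \<open>t\<close>, so evaluating them at opposite ends of the interval brackets
  the value.\<close>
lemma lam_10_critical_value: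
  assumes "0.69475 \<le> t0" "t0 \<le> (0.6948 :: real)"
  shows "\<bar>lam_10 t0 - 2.31\<bar> \<le> 0.005"
proof -
  have mono: "(1 + a + a\<^sup>2) ^ 4 / (b * (1 + b) ^ 5) \<le> (1 + c + c\<^sup>2) ^ 4 / (d * (1 + d) ^ 5)"
    if "0 < a" "a \<le> c" "0 < d" "d \<le> b" for a b c d :: real
  proof (rule frac_le)
    show "(1 + a + a\<^sup>2) ^ 4 \<le> (1 + c + c\<^sup>2) ^ 4"
      using that by (intro power_mono add_mono) auto
    show "d * (1 + d) ^ 5 \<le> b * (1 + b) ^ 5"
      using that by (intro mult_mono power_mono) auto
    show "0 < d * (1 + d) ^ 5" using that by simp
  qed simp
  have "2.305 \<le> (1 + 0.69475 + 0.69475\<^sup>2) ^ 4 / (0.6948 * (1 + 0.6948 :: real) ^ 5)"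
    by (simp add: eval_nat_numeral)
  also have "\<dots> \<le> lam_10 t0"
    unfolding lam_10_def by (rule mono) (use assms in auto)
  finally have lower: "2.305 \<le> lam_10 t0" .
  have "lam_10 t0 \<le> (1 + 0.6948 + 0.6948\<^sup>2) ^ 4 / (0.69475 * (1 + 0.69475) ^ 5)"
    unfolding lam_10_def by (rule mono) (use assms in auto)
  also have "\<dots> \<le> 2.315" by (simp add: eval_nat_numeral)
  finally have "lam_10 t0 \<le> 2.315" .
  with lower show ?thesis unfolding abs_le_iff by simp
qed

section \<open>Critical activities for branching number four\<close>
lemma parametrization_or_swap:
  assumes "(m = i \<and> r = j) \<or> (m = j \<and> r = i)"
    and par: "asym_solutions k lam i j = \<psi> ` T" and inj: "inj_on \<psi> T"
  shows "asym_solutions k lam m r = (if m = i \<and> r = j then \<psi> else prod.swap \<circ> \<psi>) ` T"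
    and "inj_on (if m = i \<and> r = j then \<psi> else prod.swap \<circ> \<psi>) T"
proof -
  have "asym_solutions k lam j i = (prod.swap \<circ> \<psi>) ` T"
    unfolding asym_solutions_swap[of k lam j i] par by (rule image_comp)
  then show "asym_solutions k lam m r = (if m = i \<and> r = j then \<psi> else prod.swap \<circ> \<psi>) ` T"
    using assms(1) par by auto
  show "inj_on (if m = i \<and> r = j then \<psi> else prod.swap \<circ> \<psi>) T"
    using inj by (auto intro: comp_inj_on)
qed

lemma transition_1_0:
  assumes mr: "(m = 1 \<and> r = 0) \<or> (m = 0 \<and> r = (1::nat))"
  shows "\<exists>lam_cr. \<bar>lam_cr - 2.31\<bar> \<le> 0.005 \<and>
    (\<forall>a. hl_arrangement 4 m r a \<longrightarrow> AGM_transition 4 m r a lam_cr (81 / 32))"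
proof -
  obtain t0 :: real where t0: "0.69475 \<le> t0" "t0 \<le> 0.6948"
    and neg: "\<And>t. 0 < t \<Longrightarrow> t < t0 \<Longrightarrow> 2 * t ^ 3 + 5 * t\<^sup>2 - 3 * t - 1 < 0"
    and pos: "\<And>t. t0 < t \<Longrightarrow> 2 * t ^ 3 + 5 * t\<^sup>2 - 3 * t - 1 > 0"
    using lam_10_critical_point by blast
  have lt: "m < 4" "r < 4" and t0': "t0 > 0" "t0 \<noteq> 1" using mr t0 by auto
  have S: "1 + t + t\<^sup>2 > 0" if "t > 0" for t :: real using that by (simp add: add_pos_pos)
  have "lam_10 1 = 81 / 32" by (simp add: lam_10_def)
  moreover have "AGM_transition 4 m r a (lam_10 t0) (lam_10 1)" if a: "hl_arrangement 4 m r a" for a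
  proof (rule AGM_transition_of_unimodal[OF lt a
      parametrization_or_swap(1)[OF mr asym_solutions_1_0 inj_on_param_1_0]
      parametrization_or_swap(2)[OF mr asym_solutions_1_0 inj_on_param_1_0] branch_lambda_pos(1) t0'
      lam_10_has_derivative _ _ branch_lambda_limits(1,2)])
    show "(1 + t + t\<^sup>2) ^ 3 * (2 * t ^ 3 + 5 * t\<^sup>2 - 3 * t - 1) / (t\<^sup>2 * (1 + t) ^ 6) < 0"
      if "0 < t" "t < t0" for t
      using neg[OF that] S[OF that(1)] that
      by (intro divide_neg_pos mult_pos_neg mult_pos_pos zero_less_power) auto
    show "(1 + t + t\<^sup>2) ^ 3 * (2 * t ^ 3 + 5 * t\<^sup>2 - 3 * t - 1) / (t\<^sup>2 * (1 + t) ^ 6) > 0"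
      if "t0 < t" for t
      using pos[OF that] S[of t] that t0'
      by (intro divide_pos_pos mult_pos_pos zero_less_power) auto
  qed simp_all
  ultimately show ?thesis using lam_10_critical_value[OF t0] by metis
qed

lemma transition_2_0:
  assumes mr: "(m = 2 \<and> r = 0) \<or> (m = 0 \<and> r = (2::nat))"
  shows "\<exists>lam_cr. \<bar>lam_cr - 9.48\<bar> \<le> 0.005 \<and>
    (\<forall>a. hl_arrangement 4 m r a \<longrightarrow> AGM_transition 4 m r a lam_cr 16)"
proof -
  have lt: "m < 4" "r < 4" using mr by auto
  have "lam_20 1 = 16" "\<bar>lam_20 (1/3) - 9.48\<bar> \<le> 0.005"
    by (simp_all add: lam_20_def eval_nat_numeral)
  moreover have "AGM_transition 4 m r a (lam_20 (1/3)) (lam_20 1)" if a: "hl_arrangement 4 m r a" for a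
  proof (rule AGM_transition_of_unimodal[OF lt a
      parametrization_or_swap(1)[OF mr asym_solutions_2_0 inj_on_param_hyperbola]
      parametrization_or_swap(2)[OF mr asym_solutions_2_0 inj_on_param_hyperbola] branch_lambda_pos(3) _ _
      lam_20_has_derivative _ _ branch_lambda_limits(5,6)])
    show "(1 + t) ^ 3 * (3 * t - 1) / t\<^sup>2 < 0" if "0 < t" "t < 1/3" for t :: real
      using that by (intro divide_neg_pos mult_pos_neg zero_less_power) auto
    show "(1 + t) ^ 3 * (3 * t - 1) / t\<^sup>2 > 0" if "1/3 < t" for t :: real
      using that by (intro divide_pos_pos mult_pos_pos zero_less_power) auto
  qed simp_all
  ultimately show ?thesis by metis
qed

text \<open>Here the minimum of the activity lies at \<open>t = 1\<close>, on the diagonal itself: at the critical value no solution off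
  the diagonal exists yet, and \<open>t \<mapsto> 1/t\<close> exchanges the two that appear above it.\<close>
lemma transition_1_1:
  assumes a: "hl_arrangement 4 1 1 a"
  shows "0 < lam \<Longrightarrow> lam \<le> 16 \<Longrightarrow>
      \<exists>\<mu>0. hc_TIGMs 4 lam = {\<mu>0} \<and> hc_AGMs 4 lam 1 1 a = {\<mu>0}"
    and "lam > 16 \<Longrightarrow>
      \<exists>\<mu>0 \<mu>1 \<mu>2. hc_TIGMs 4 lam = {\<mu>0} \<and> hc_AGMs 4 lam 1 1 a = {\<mu>0, \<mu>1, \<mu>2} \<and>
        \<mu>1 \<noteq> \<mu>2 \<and> \<mu>1 \<notin> hc_TIGMs 4 lam \<and> \<mu>2 \<notin> hc_TIGMs 4 lam"
proof -
  let ?D = "\<lambda>t::real. (1 + t) ^ 3 * (2 * t - 2) / t ^ 3"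
  let ?\<psi> = "\<lambda>t. (t / lam, 1 / t / lam)"
  have val: "lam_11 1 = 16" by (simp add: lam_11_def)
  have neg: "?D t < 0" if "0 < t" "t < 1" for t
    using that by (intro divide_neg_pos mult_pos_neg zero_less_power) auto
  have pos: "?D t > 0" if "1 < t" for t
    using that by (intro divide_pos_pos mult_pos_pos zero_less_power) auto
  have level1: "{t. 0 < t \<and> lam_11 t = c} = {}" if "c < 16" for c
    by (rule level_sets_of_unimodal(1)[OF zero_less_one lam_11_has_derivative neg pos branch_lambda_limits(3,4)])
       (use that val in simp_all)
  have level2: "{t. 0 < t \<and> lam_11 t = 16} = {1}"
    using level_sets_of_unimodal(2)[OF zero_less_one lam_11_has_derivative neg pos branch_lambda_limits(3,4)]
    by (simp add: val)
  have level3: "\<exists>t1 t2. 0 < t1 \<and> t1 < 1 \<and> 1 < t2 \<and> {t. 0 < t \<and> lam_11 t = c} = {t1, t2}"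
    if "16 < c" for c
    by (rule level_sets_of_unimodal(3)[OF zero_less_one lam_11_has_derivative neg pos branch_lambda_limits(3,4)])
       (use that val in simp_all)
  have drop1: "{t. 0 < t \<and> t \<noteq> 1 \<and> lam_11 t = lam} = {t. 0 < t \<and> lam_11 t = lam} - {1}" by auto
  show "\<exists>\<mu>0. hc_TIGMs 4 lam = {\<mu>0} \<and> hc_AGMs 4 lam 1 1 a = {\<mu>0}" if lam: "0 < lam" "lam \<le> 16"
  proof (rule AGM_count(1)[OF lam(1) _ _ a])
    have "{t. 0 < t \<and> lam_11 t = lam} - {1} = {}"
      using level1[of lam] level2 lam by (cases "lam = 16") auto
    then show "asym_solutions 4 lam 1 1 = {}"
      unfolding asym_solutions_1_1[OF lam(1)] drop1 by simp
  qed simp_all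
  show "\<exists>\<mu>0 \<mu>1 \<mu>2. hc_TIGMs 4 lam = {\<mu>0} \<and> hc_AGMs 4 lam 1 1 a = {\<mu>0, \<mu>1, \<mu>2} \<and>
        \<mu>1 \<noteq> \<mu>2 \<and> \<mu>1 \<notin> hc_TIGMs 4 lam \<and> \<mu>2 \<notin> hc_TIGMs 4 lam" if lam: "lam > 16"
  proof -
    have "lam > 0" using lam by simp
    obtain t1 t2 where t: "t1 < 1" "1 < t2" and eq: "{t. 0 < t \<and> lam_11 t = lam} = {t1, t2}"
      using level3[OF lam] by blast
    have two: "asym_solutions 4 lam 1 1 = {?\<psi> t1, ?\<psi> t2}"
      unfolding asym_solutions_1_1[OF \<open>lam > 0\<close>] drop1 eq using t by auto
    have "?\<psi> t1 \<noteq> ?\<psi> t2" using t \<open>lam > 0\<close> by simp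
    from AGM_count(3)[OF \<open>lam > 0\<close> _ _ a two this] show ?thesis by simp
  qed
qed

theorem theorem4:
  shows
    "(\<forall>m r :: nat. (m = 1 \<and> r = 0) \<or> (m = 0 \<and> r = 1) \<longrightarrow>
       (\<exists>lam_cr :: real. \<bar>lam_cr - 2.31\<bar> \<le> 0.005 \<and>
         (\<forall>a. hl_arrangement 4 m r a \<longrightarrow>
           (\<forall>lam. 0 < lam \<and> lam < lam_cr \<longrightarrow>
             (\<exists>\<mu>0. hc_TIGMs 4 lam = {\<mu>0} \<and> hc_AGMs 4 lam m r a = {\<mu>0})) \<and>
           (\<forall>lam. lam = lam_cr \<or> lam = 81 / 32 \<longrightarrow>
             (\<exists>\<mu>0 \<mu>'. hc_TIGMs 4 lam = {\<mu>0} \<and> hc_AGMs 4 lam m r a = {\<mu>0, \<mu>'} \<and>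
               \<mu>' \<notin> hc_TIGMs 4 lam)) \<and>
           (\<forall>lam. lam > lam_cr \<and> lam \<noteq> 81 / 32 \<longrightarrow>
             (\<exists>\<mu>0 \<mu>1 \<mu>2. hc_TIGMs 4 lam = {\<mu>0} \<and> hc_AGMs 4 lam m r a = {\<mu>0, \<mu>1, \<mu>2} \<and>
               \<mu>1 \<noteq> \<mu>2 \<and> \<mu>1 \<notin> hc_TIGMs 4 lam \<and> \<mu>2 \<notin> hc_TIGMs 4 lam)))))
     \<and>
     (\<forall>a. hl_arrangement 4 1 1 a \<longrightarrow>
       (\<forall>lam. 0 < lam \<and> lam \<le> 16 \<longrightarrow>
         (\<exists>\<mu>0. hc_TIGMs 4 lam = {\<mu>0} \<and> hc_AGMs 4 lam 1 1 a = {\<mu>0})) \<and>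
       (\<forall>lam. lam > 16 \<longrightarrow>
         (\<exists>\<mu>0 \<mu>1 \<mu>2. hc_TIGMs 4 lam = {\<mu>0} \<and> hc_AGMs 4 lam 1 1 a = {\<mu>0, \<mu>1, \<mu>2} \<and>
           \<mu>1 \<noteq> \<mu>2 \<and> \<mu>1 \<notin> hc_TIGMs 4 lam \<and> \<mu>2 \<notin> hc_TIGMs 4 lam)))
     \<and>
     (\<forall>m r :: nat. (m = 2 \<and> r = 0) \<or> (m = 0 \<and> r = 2) \<longrightarrow>
       (\<exists>lam_cr :: real. \<bar>lam_cr - 9.48\<bar> \<le> 0.005 \<and>
         (\<forall>a. hl_arrangement 4 m r a \<longrightarrow>
           (\<forall>lam. 0 < lam \<and> lam < lam_cr \<longrightarrow>
             (\<exists>\<mu>0. hc_TIGMs 4 lam = {\<mu>0} \<and> hc_AGMs 4 lam m r a = {\<mu>0})) \<and>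
           (\<forall>lam. lam = lam_cr \<or> lam = 16 \<longrightarrow>
             (\<exists>\<mu>0 \<mu>'. hc_TIGMs 4 lam = {\<mu>0} \<and> hc_AGMs 4 lam m r a = {\<mu>0, \<mu>'} \<and>
               \<mu>' \<notin> hc_TIGMs 4 lam)) \<and>
           (\<forall>lam. lam > lam_cr \<and> lam \<noteq> 16 \<longrightarrow>
             (\<exists>\<mu>0 \<mu>1 \<mu>2. hc_TIGMs 4 lam = {\<mu>0} \<and> hc_AGMs 4 lam m r a = {\<mu>0, \<mu>1, \<mu>2} \<and>
               \<mu>1 \<noteq> \<mu>2 \<and> \<mu>1 \<notin> hc_TIGMs 4 lam \<and> \<mu>2 \<notin> hc_TIGMs 4 lam)))))"
  by (intro conjI allI impI transition_1_0[unfolded AGM_transition_def] transition_1_1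
      transition_2_0[unfolded AGM_transition_def]) auto

end
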